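(* Let $S_{\boldsymbol\lambda}$ be a densely defined weighted shift on a directed tree $\mathcal T=(V,E)$ with weights $\boldsymbol\lambda=\{\lambda_v\}_{v\in V^\circ}$, and let $S_{\boldsymbol\lambda}=U|S_{\boldsymbol\lambda}|$ be the polar decomposition of $S_{\boldsymbol\lambda}$. Put $V^+_{\boldsymbol\lambda}=\{u\in V:\|S_{\boldsymbol\lambda}e_u\|>0\}$. Then $|S_{\boldsymbol\lambda}|$ is the diagonal operator subordinated to the orthonormal basis $\{e_u\}_{u\in V}$ with diagonal elements $\{\|S_{\boldsymbol\lambda}e_u\|\}_{u\in V}$, and $U$ is the weighted shift $S_{\boldsymbol\pi}$ on $\mathcal T$ with weights $\boldsymbol\pi=\{\pi_u\}_{u\in V^\circ}$ given by $$\pi_u=\begin{cases}\dfrac{\lambda_u}{\|S_{\boldsymbol\lambda}e_{\operatorname{par}(u)}\|}&\text{if }\operatorname{par}(u)\in V^+_{\boldsymbol\lambda},\\ 0&\text{if }\operatorname{par}(u)\notin V^+_{\boldsymbol\lambda},\end{cases}\qquad u\in V^\circ.$$ Moreover, the following assertions hold, where $\mathcal N(\cdot)$ and $\mathcal R(\cdot)$ denote kernel and range: (i) $\mathcal N(U)=\mathcal N(S_{\boldsymbol\lambda})=\mathcal N(|S_{\boldsymbol\lambda}|)=\ell^2(V\setminus V^+_{\boldsymbol\lambda})$ and $\overline{\mathcal R(S_{\boldsymbol\lambda}^* )}=\ell^2(V^+_{\boldsymbol\lambda})$; (ii) $\mathcal N(S_{\boldsymbol\lambda}^* )=\langle e_{\mathrm{root}}\rangle\oplus\bigoplus_{u\in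 V'}\big(\ell^2(\operatorname{Chi}(u))\ominus\langle\boldsymbol\lambda^u\rangle\big)$ if $\mathcal T$ has a root, and $\mathcal N(S_{\boldsymbol\lambda}^* )=\bigoplus_{u\in V'}\big(\ell^2(\operatorname{Chi}(u))\ominus\langle\boldsymbol\lambda^u\rangle\big)$ otherwise, where $\boldsymbol\lambda^u\in\ell^2(\operatorname{Chi}(u))$ is given by $\boldsymbol\lambda^u\colon\operatorname{Chi}(u)\ni v\mapsto\lambda_v\in\mathbb C$, and $\langle x\rangle$ is the linear span of $\{x\}$; (iii) the initial space of $U$ equals $\ell^2(V^+_{\boldsymbol\lambda})$; (iv) $\mathcal R(U)=\overline{\mathcal R(S_{\boldsymbol\lambda})}=\bigoplus_{u\in V'}\langle\boldsymbol\lambda^u\rangle$.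
   Context: A directed tree $\mathcal T=(V,E)$ consists of a nonempty set $V$ (of arbitrary cardinality) of vertices and a set $E\subseteq V\times V\setminus\{(v,v):v\in V\}$ of edges such that: (1) any two distinct vertices $u,v$ are joined by an undirected path, i.e. there are $v_1=u,\dots,v_n=v$ in $V$ ($n\ge 2$) with $(v_j,v_{j+1})\in E$ or $(v_{j+1},v_j)\in E$ for each $j<n$; (2) there is no circuit, i.e. no finite sequence of distinct vertices $u_1,\dots,u_n$ ($n\ge2$) with $(u_j,u_{j+1})\in E$ for $j<n$ and $(u_n,u_1)\in E$; (3) every vertex $v$ that is not a root has a unique vertex $\operatorname{par}(v)$ (its parent) with $(\operatorname{par}(v),v)\in E$; a root is a vertex $v$ for which there is no $u$ with $(u,v)\in E$. A directed tree has at most one root, denoted $\mathrm{root}$ when it exists. $V^\circ$ is $V$ with the root removed (and $V^\circ=V$ if $\mathcal T$ has no root). $\operatorname{Chi}(u)=\{v\in V:(u,v)\in E\}$ is the set of children of $u$, and $V'=\{u\in V:\operatorname{Chi}(u)\ne\varnothing\}$. $\ell^2(V)$ is the Hilbert space of square summable complex functions on $V$, with orthonormal basis $\{e_u\}_{u\in V}$, $e_u$ being the indicator function of $\{u\}$. For $W\subseteq V$, $\ell^2(W)$ is regarded as the closed subspace of $\ell^2(V)$ of functions vanishing off $W$. For $\boldsymbol\lambda=\{\lambda_v\}_{v\in V^\circ}\subseteq\mathbb C$ and $f\colon V\to\mathbb C$ put $(\Lambda f)(v)=\lambda_v f(\operatorname{par}(v))$ for $v\in V^\circ$ and $(\Lambda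 f)(\mathrm{root})=0$. The weighted shift $S_{\boldsymbol\lambda}$ is the operator in $\ell^2(V)$ with domain $\mathcal D(S_{\boldsymbol\lambda})=\{f\in\ell^2(V):\Lambda f\in\ell^2(V)\}$ and $S_{\boldsymbol\lambda}f=\Lambda f$. It is closed, and it is densely defined if and only if every $e_u$ lies in its domain, in which case $\|S_{\boldsymbol\lambda}e_u\|^2=\sum_{v\in\operatorname{Chi}(u)}|\lambda_v|^2<\infty$ (sum over the empty set is $0$). The polar decomposition of a closed densely defined operator $T$ is $T=U|T|$ with $|T|=(T^*T)^{1/2}$ and $U$ the unique partial isometry with initial space $\overline{\mathcal R(|T|)}$. The diagonal operator subordinated to an orthonormal basis $\{e_u\}$ with diagonal elements $\{t_u\}\subseteq[0,\infty)$ is the positive selfadjoint operator $A$ with $e_u\in\mathcal D(A)$ and $Ae_u=t_ue_u$ for all $u$. *)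

theory Defs
  imports "HOL-Analysis.Analysis" "HOL-Library.Set_Algebras"
begin

subsection \<open>The complex Hilbert space of square summable functions\<close>

typedef 'a ell2 = "{f :: 'a \<Rightarrow> complex. (\<lambda>x. (cmod (f x))\<^sup>2) summable_on UNIV}"
  morphisms ell2_fun Abs_ell2
proof
  show "(\<lambda>_. 0) \<in> {f :: 'a \<Rightarrow> complex. (\<lambda>x. (cmod (f x))\<^sup>2) summable_on UNIV}"
    by simp
qed

setup_lifting type_definition_ell2

lemma ell2_summable: "(\<lambda>x. (cmod (ell2_fun f x))\<^sup>2) summable_on UNIV"
  using ell2_fun[of f] by simp

lemma ell2_eqI: "(\<And>x. ell2_fun f x = ell2_fun g x) \<Longrightarrow> f = g"
  unfolding ell2_fun_inject[symmetric] by (rule ext)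

lemma cmod_add_power2_le: "(cmod (a + b))\<^sup>2 \<le> 2 * (cmod a)\<^sup>2 + 2 * (cmod b)\<^sup>2"
proof -
  have "(cmod (a + b))\<^sup>2 \<le> (cmod a + cmod b)\<^sup>2"
    by (intro power_mono norm_triangle_ineq) auto
  also have "\<dots> \<le> 2 * (cmod a)\<^sup>2 + 2 * (cmod b)\<^sup>2"
    using sum_squares_bound[of "cmod a" "cmod b"] by (simp add: power2_sum)
  finally show ?thesis .
qed

lemma square_summable_add:
  fixes f g :: "'a \<Rightarrow> complex"
  assumes "(\<lambda>x. (cmod (f x))\<^sup>2) summable_on A" "(\<lambda>x. (cmod (g x))\<^sup>2) summable_on A"
  shows "(\<lambda>x. (cmod (f x + g x))\<^sup>2) summable_on A"
proof (rule summable_on_comparison_test)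
  show "(\<lambda>x. 2 * (cmod (f x))\<^sup>2 + 2 * (cmod (g x))\<^sup>2) summable_on A"
    by (intro summable_on_add summable_on_cmult_right assms)
qed (auto simp: cmod_add_power2_le)

lemma square_summable_scale:
  fixes f :: "'a \<Rightarrow> complex"
  assumes "(\<lambda>x. (cmod (f x))\<^sup>2) summable_on A"
  shows "(\<lambda>x. (cmod (c * f x))\<^sup>2) summable_on A"
  by (simp add: norm_mult power_mult_distrib summable_on_cmult_right assms)

instantiation ell2 :: (type) real_vector
begin

lift_definition zero_ell2 :: "'a ell2" is "\<lambda>_. 0"
  by simp

lift_definition plus_ell2 :: "'a ell2 \<Rightarrow> 'a ell2 \<Rightarrow> 'a ell2" is "\<lambda>f g x. f x + g x"
  by (simp add: square_summable_add)

lift_definition uminus_ell2 :: "'a ell2 \<Rightarrow> 'a ell2" is "\<lambda>f x. - f x"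
  by simp

lift_definition minus_ell2 :: "'a ell2 \<Rightarrow> 'a ell2 \<Rightarrow> 'a ell2" is "\<lambda>f g x. f x - g x"
  subgoal for f g using square_summable_add[of f UNIV "\<lambda>x. - g x"] by simp
  done

lift_definition scaleR_ell2 :: "real \<Rightarrow> 'a ell2 \<Rightarrow> 'a ell2" is "\<lambda>r f x. complex_of_real r * f x"
  by (simp add: square_summable_scale)

instance
  by standard
    (simp_all add: ell2_eqI plus_ell2.rep_eq zero_ell2.rep_eq uminus_ell2.rep_eq minus_ell2.rep_eq
      scaleR_ell2.rep_eq algebra_simps)

end

lift_definition scaleC :: "complex \<Rightarrow> 'a ell2 \<Rightarrow> 'a ell2"  (infixr \<open>*\<^sub>C\<close> 75)
  is "\<lambda>c f x. c * f x"
  by (simp add: square_summable_scale)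

interpretation cvec: vector_space "scaleC :: complex \<Rightarrow> 'a ell2 \<Rightarrow> 'a ell2"
  by unfold_locales (simp_all add: ell2_eqI plus_ell2.rep_eq scaleC.rep_eq algebra_simps)

definition cinner :: "'a ell2 \<Rightarrow> 'a ell2 \<Rightarrow> complex"
  where "cinner f g = (\<Sum>\<^sub>\<infinity>x. ell2_fun f x * cnj (ell2_fun g x))"

lemma cinner_summable: "(\<lambda>x. ell2_fun f x * cnj (ell2_fun g x)) summable_on UNIV"
proof -
  have "cmod (ell2_fun f x * cnj (ell2_fun g x)) \<le> (cmod (ell2_fun f x))\<^sup>2 + (cmod (ell2_fun g x))\<^sup>2" for x
  proof -
    have "0 \<le> cmod (ell2_fun f x) * cmod (ell2_fun g x)" by simp
    with sum_squares_bound[of "cmod (ell2_fun f x)" "cmod (ell2_fun g x)"] show ?thesis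
      unfolding norm_mult complex_mod_cnj by linarith
  qed
  hence "(\<lambda>x. cmod (ell2_fun f x * cnj (ell2_fun g x))) summable_on UNIV"
    by (intro summable_on_comparison_test[OF summable_on_add[OF ell2_summable[of f] ell2_summable[of g]]]) simp_all
  thus ?thesis by (rule abs_summable_summable)
qed

lemma cinner_self: "cinner f f = complex_of_real (\<Sum>\<^sub>\<infinity>x. (cmod (ell2_fun f x))\<^sup>2)"
proof -
  have "((\<lambda>x. complex_of_real ((cmod (ell2_fun f x))\<^sup>2))
          has_sum complex_of_real (\<Sum>\<^sub>\<infinity>x. (cmod (ell2_fun f x))\<^sup>2)) UNIV"
    unfolding has_sum_of_real_iff by (rule has_sum_infsum[OF ell2_summable])
  thus ?thesis
    unfolding cinner_def complex_norm_square by (rule infsumI)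
qed

lemma cinner_cnj: "cinner g f = cnj (cinner f g)"
  unfolding cinner_def infsum_cnj[symmetric] by (simp add: mult.commute)

lemma cinner_add_left: "cinner (f + g) h = cinner f h + cinner g h"
  unfolding cinner_def
  by (subst infsum_add[symmetric]) (auto simp: cinner_summable plus_ell2.rep_eq algebra_simps)

lemma cinner_scaleC_left: "cinner (c *\<^sub>C f) h = c * cinner f h"
  unfolding cinner_def
  by (subst infsum_cmult_right[symmetric]) (auto simp: cinner_summable scaleC.rep_eq algebra_simps)

lemma scaleR_scaleC: "r *\<^sub>R f = complex_of_real r *\<^sub>C (f :: 'a ell2)"
  by (simp add: ell2_eqI scaleR_ell2.rep_eq scaleC.rep_eq)

instantiation ell2 :: (type) real_inner
begin

definition inner_ell2 :: "'a ell2 \<Rightarrow> 'a ell2 \<Rightarrow> real"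
  where "inner_ell2 f g = Re (cinner f g)"

definition norm_ell2 :: "'a ell2 \<Rightarrow> real"
  where "norm_ell2 f = sqrt (\<Sum>\<^sub>\<infinity>x. (cmod (ell2_fun f x))\<^sup>2)"

definition dist_ell2 :: "'a ell2 \<Rightarrow> 'a ell2 \<Rightarrow> real"
  where "dist_ell2 f g = norm (f - g)"

definition sgn_ell2 :: "'a ell2 \<Rightarrow> 'a ell2"
  where "sgn_ell2 f = f /\<^sub>R norm f"

definition uniformity_ell2 :: "('a ell2 \<times> 'a ell2) filter"
  where "uniformity_ell2 = (INF e\<in>{0 <..}. principal {(f, g). dist f g < e})"

definition open_ell2 :: "'a ell2 set \<Rightarrow> bool"
  where "open_ell2 U = (\<forall>f\<in>U. eventually (\<lambda>(f', g). f' = f \<longrightarrow> g \<in> U) uniformity)"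

instance
proof
  fix f g h :: "'a ell2" and r :: real and U :: "'a ell2 set"
  show "dist f g = norm (f - g)" by (rule dist_ell2_def)
  show "sgn f = f /\<^sub>R norm f" by (rule sgn_ell2_def)
  show "uniformity = (INF e\<in>{0 <..}. principal {(f, g :: 'a ell2). dist f g < e})"
    by (rule uniformity_ell2_def)
  show "open U = (\<forall>f\<in>U. eventually (\<lambda>(f', g). f' = f \<longrightarrow> g \<in> U) uniformity)"
    by (rule open_ell2_def)
  show "inner f g = inner g f"
    unfolding inner_ell2_def by (subst cinner_cnj) simp
  show "inner (f + g) h = inner f h + inner g h"
    by (simp add: inner_ell2_def cinner_add_left)
  show "inner (r *\<^sub>R f) g = r * inner f g"
    by (simp add: inner_ell2_def scaleR_scaleC cinner_scaleC_left)
  show "0 \<le> inner f f"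
    by (simp add: inner_ell2_def cinner_self infsum_nonneg)
  show "norm f = sqrt (inner f f)"
    by (simp add: inner_ell2_def norm_ell2_def cinner_self)
  show "inner f f = 0 \<longleftrightarrow> f = 0"
  proof
    assume "inner f f = 0"
    hence "(\<Sum>\<^sub>\<infinity>x. (cmod (ell2_fun f x))\<^sup>2) = 0"
      by (simp add: inner_ell2_def cinner_self)
    hence "(cmod (ell2_fun f x))\<^sup>2 = 0" for x
      using nonneg_infsum_le_0D[OF _ ell2_summable, of f x] by simp
    thus "f = 0" by (intro ell2_eqI) (simp add: zero_ell2.rep_eq)
  qed (simp add: inner_ell2_def cinner_def zero_ell2.rep_eq)
qed

end

lemma cmod_ell2_fun_le_norm: "cmod (ell2_fun f x) \<le> norm f"
proof -
  have "(\<Sum>x\<in>{x}. (cmod (ell2_fun f x))\<^sup>2) \<le> (\<Sum>\<^sub>\<infinity>x. (cmod (ell2_fun f x))\<^sup>2)"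
    by (intro finite_sum_le_infsum ell2_summable) auto
  thus ?thesis unfolding norm_ell2_def by (simp add: real_le_rsqrt)
qed

lemma sum_cmod_ell2_fun_le_norm:
  assumes "finite F"
  shows "(\<Sum>x\<in>F. (cmod (ell2_fun f x))\<^sup>2) \<le> (norm f)\<^sup>2"
proof -
  have "(\<Sum>x\<in>F. (cmod (ell2_fun f x))\<^sup>2) \<le> (\<Sum>\<^sub>\<infinity>x. (cmod (ell2_fun f x))\<^sup>2)"
    by (intro finite_sum_le_infsum ell2_summable assms) auto
  also have "\<dots> = (norm f)\<^sup>2"
    unfolding norm_ell2_def by (simp add: infsum_nonneg)
  finally show ?thesis .
qed

instance ell2 :: (type) complete_space
proof
  fix X :: "nat \<Rightarrow> 'a ell2"
  assume X: "Cauchy X"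
  have "Cauchy (\<lambda>n. ell2_fun (X n) x)" for x
  proof (rule metric_CauchyI)
    fix e :: real assume "e > 0"
    then obtain N where N: "\<forall>m\<ge>N. \<forall>n\<ge>N. dist (X m) (X n) < e"
      using metric_CauchyD[OF X] by blast
    have "dist (ell2_fun (X m) x) (ell2_fun (X n) x) \<le> dist (X m) (X n)" for m n
      using cmod_ell2_fun_le_norm[of "X m - X n" x] by (simp add: dist_norm minus_ell2.rep_eq)
    thus "\<exists>M. \<forall>m\<ge>M. \<forall>n\<ge>M. dist (ell2_fun (X m) x) (ell2_fun (X n) x) < e"
      using N by (meson le_less_trans)
  qed
  hence "convergent (\<lambda>n. ell2_fun (X n) x)" for x
    by (rule Cauchy_convergent)
  moreover define L where "L = (\<lambda>x. lim (\<lambda>n. ell2_fun (X n) x))"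
  ultimately have L: "(\<lambda>n. ell2_fun (X n) x) \<longlonglongrightarrow> L x" for x
    by (simp add: convergent_LIMSEQ_iff)
  have bound: "\<exists>N. \<forall>n\<ge>N. \<forall>F. finite F \<longrightarrow> (\<Sum>x\<in>F. (cmod (ell2_fun (X n) x - L x))\<^sup>2) \<le> e\<^sup>2"
    if "e > 0" for e :: real
  proof -
    obtain N where N: "\<And>m n. m \<ge> N \<Longrightarrow> n \<ge> N \<Longrightarrow> dist (X m) (X n) < e"
      using metric_CauchyD[OF X \<open>e > 0\<close>] by auto
    have "(\<Sum>x\<in>F. (cmod (ell2_fun (X n) x - L x))\<^sup>2) \<le> e\<^sup>2" if n: "n \<ge> N" and F: "finite F" for n F
    proof (rule LIMSEQ_le_const2)
      show "(\<lambda>m. \<Sum>x\<in>F. (cmod (ell2_fun (X n) x - ell2_fun (X m) x))\<^sup>2)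
              \<longlonglongrightarrow> (\<Sum>x\<in>F. (cmod (ell2_fun (X n) x - L x))\<^sup>2)"
        by (intro tendsto_intros L)
      have "(\<Sum>x\<in>F. (cmod (ell2_fun (X n) x - ell2_fun (X m) x))\<^sup>2) \<le> e\<^sup>2" if "m \<ge> N" for m
      proof -
        have "(\<Sum>x\<in>F. (cmod (ell2_fun (X n) x - ell2_fun (X m) x))\<^sup>2) \<le> (norm (X n - X m))\<^sup>2"
          using sum_cmod_ell2_fun_le_norm[OF F, of "X n - X m"] by (simp add: minus_ell2.rep_eq)
        also have "\<dots> \<le> e\<^sup>2"
          using N[OF n that] by (intro power_mono) (auto simp: dist_norm)
        finally show ?thesis .
      qed
      thus "\<exists>N. \<forall>m\<ge>N. (\<Sum>x\<in>F. (cmod (ell2_fun (X n) x - ell2_fun (X m) x))\<^sup>2) \<le> e\<^sup>2"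
        by blast
    qed
    thus ?thesis by blast
  qed
  have summ: "(\<lambda>x. (cmod (ell2_fun (X n) x - L x))\<^sup>2) summable_on UNIV"
    if "\<forall>F. finite F \<longrightarrow> (\<Sum>x\<in>F. (cmod (ell2_fun (X n) x - L x))\<^sup>2) \<le> e\<^sup>2" for n and e :: real
    using that by (intro nonneg_bdd_above_summable_on) (auto simp: bdd_above_def)
  obtain n where "\<forall>F. finite F \<longrightarrow> (\<Sum>x\<in>F. (cmod (ell2_fun (X n) x - L x))\<^sup>2) \<le> 1\<^sup>2"
    using bound[of 1] by auto
  from square_summable_add[OF ell2_summable[of "- X n"] summ[OF this]]
  have "(\<lambda>x. (cmod (L x))\<^sup>2) summable_on UNIV"
    by (simp add: uminus_ell2.rep_eq)
  hence repL: "ell2_fun (Abs_ell2 L) = L"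
    by (simp add: Abs_ell2_inverse)
  have "X \<longlonglongrightarrow> Abs_ell2 L"
  proof (rule metric_LIMSEQ_I)
    fix e :: real assume "e > 0"
    then obtain N where N: "\<And>n F. n \<ge> N \<Longrightarrow> finite F \<Longrightarrow>
        (\<Sum>x\<in>F. (cmod (ell2_fun (X n) x - L x))\<^sup>2) \<le> (e / 2)\<^sup>2"
      using bound[of "e / 2"] by auto
    have "dist (X n) (Abs_ell2 L) < e" if "n \<ge> N" for n
    proof -
      have "(\<Sum>\<^sub>\<infinity>x. (cmod (ell2_fun (X n) x - L x))\<^sup>2) \<le> (e / 2)\<^sup>2"
        using N[OF that] by (intro infsum_le_finite_sums summ[of n "e / 2"]) blast+
      hence "norm (X n - Abs_ell2 L) \<le> e / 2"
        unfolding norm_ell2_def minus_ell2.rep_eq repL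
        using \<open>e > 0\<close> by (intro real_le_lsqrt) auto
      thus ?thesis using \<open>e > 0\<close> by (simp add: dist_norm)
    qed
    thus "\<exists>N. \<forall>n\<ge>N. dist (X n) (Abs_ell2 L) < e" by blast
  qed
  thus "convergent X" by (auto simp: convergent_def)
qed

lift_definition basis_vec :: "'a \<Rightarrow> 'a ell2" is "\<lambda>u. indicator {u}"
proof -
  fix u :: 'a
  have "(\<lambda>x. (cmod (indicator {u} x))\<^sup>2) summable_on {u}" by simp
  thus "(\<lambda>x. (cmod (indicator {u} x))\<^sup>2) summable_on UNIV"
    by (rule summable_on_cong_neutral[THEN iffD1, rotated -1]) (auto simp: indicator_def)
qed

definition ell2_on :: "'a set \<Rightarrow> 'a ell2 set"
  where "ell2_on W = {f. \<forall>v. v \<notin> W \<longrightarrow> ell2_fun f v = 0}"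

subsection \<open>Orthogonality\<close>

definition orthogonal_sets :: "'a ell2 set \<Rightarrow> 'a ell2 set \<Rightarrow> bool"
  where "orthogonal_sets M N \<longleftrightarrow> (\<forall>f\<in>M. \<forall>g\<in>N. cinner f g = 0)"

text \<open>The orthogonal complement of \<open>M\<close> relative to \<open>H\<close>, i.e.\ \<open>H \<ominus> M\<close>.\<close>
definition ortho_in :: "'a ell2 set \<Rightarrow> 'a ell2 set \<Rightarrow> 'a ell2 set"  (infixl \<open>\<ominus>\<close> 65)
  where "H \<ominus> M = {f \<in> H. \<forall>g\<in>M. cinner f g = 0}"

text \<open>The Hilbert space sum of a family of subspaces; \<^const>\<open>has_sum\<close> is unconditional
  convergence in norm.\<close>
definition hilbert_sum :: "'i set \<Rightarrow> ('i \<Rightarrow> 'a ell2 set) \<Rightarrow> 'a ell2 set"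
  where "hilbert_sum I M = {f. \<exists>g. (\<forall>i\<in>I. g i \<in> M i) \<and> (g has_sum f) I}"

definition orthogonal_family :: "'i set \<Rightarrow> ('i \<Rightarrow> 'a ell2 set) \<Rightarrow> bool"
  where "orthogonal_family I M \<longleftrightarrow> (\<forall>i\<in>I. \<forall>j\<in>I. i \<noteq> j \<longrightarrow> orthogonal_sets (M i) (M j))"

definition orthonormal_basis :: "'a ell2 set \<Rightarrow> 'i set \<Rightarrow> ('i \<Rightarrow> 'a ell2) \<Rightarrow> bool"
  where "orthonormal_basis H I e \<longleftrightarrow>
    (\<forall>i\<in>I. \<forall>j\<in>I. cinner (e i) (e j) = (if i = j then 1 else 0)) \<and>
    closure (cvec.span (e ` I)) = H"

subsection \<open>Unbounded operators in a closed subspace \<open>H\<close>\<close>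

text \<open>An operator is identified with its graph, a set of pairs \<open>(f, T f)\<close>. Its domain and range
  are then \<^const>\<open>Domain\<close> and \<^const>\<open>Range\<close>, equality is equality of domains and values, and
  the operator product \<open>A B\<close> (first \<open>B\<close>, then \<open>A\<close>, on its natural domain) is \<open>B O A\<close>.\<close>

type_synonym 'a oper = "('a ell2 \<times> 'a ell2) set"

definition linear_operator :: "'a ell2 set \<Rightarrow> 'a oper \<Rightarrow> bool"
  where "linear_operator H T \<longleftrightarrow>
    T \<subseteq> H \<times> H \<and> single_valued T \<and> (0, 0) \<in> T \<and>
    (\<forall>(f, f')\<in>T. \<forall>(g, g')\<in>T. (f + g, f' + g') \<in> T) \<and>
    (\<forall>c. \<forall>(f, f')\<in>T. (c *\<^sub>C f, c *\<^sub>C f') \<in> T)"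

text \<open>The value of the operator at a vector; meaningful only on the domain.\<close>
definition app :: "'a oper \<Rightarrow> 'a ell2 \<Rightarrow> 'a ell2"  (infixl \<open>\<cdot>\<close> 90)
  where "T \<cdot> f = (THE g. (f, g) \<in> T)"

definition op_kernel :: "'a oper \<Rightarrow> 'a ell2 set"
  where "op_kernel T = {f. (f, 0) \<in> T}"

definition densely_defined :: "'a ell2 set \<Rightarrow> 'a oper \<Rightarrow> bool"
  where "densely_defined H T \<longleftrightarrow> H \<subseteq> closure (Domain T)"

definition adjoint_in :: "'a ell2 set \<Rightarrow> 'a oper \<Rightarrow> 'a oper"
  where "adjoint_in H T = {(g, h). g \<in> H \<and> h \<in> H \<and> (\<forall>(f, f')\<in>T. cinner f' g = cinner f h)}"

definition positive_selfadjoint :: "'a ell2 set \<Rightarrow> 'a oper \<Rightarrow> bool"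
  where "positive_selfadjoint H A \<longleftrightarrow>
    linear_operator H A \<and> densely_defined H A \<and> adjoint_in H A = A \<and>
    (\<forall>(f, f')\<in>A. cinner f' f \<in> \<real>\<^sub>\<ge>\<^sub>0)"

definition diagonal_operator ::
    "'a ell2 set \<Rightarrow> 'i set \<Rightarrow> ('i \<Rightarrow> 'a ell2) \<Rightarrow> ('i \<Rightarrow> real) \<Rightarrow> 'a oper \<Rightarrow> bool"
  where "diagonal_operator H I e t A \<longleftrightarrow>
    orthonormal_basis H I e \<and> (\<forall>i\<in>I. 0 \<le> t i) \<and> positive_selfadjoint H A \<and>
    (\<forall>i\<in>I. (e i, t i *\<^sub>R e i) \<in> A)"

text \<open>The modulus \<open>|T|\<close>: the unique positive selfadjoint square root of \<open>T\<^sup>* T\<close>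
  (it exists for closed densely defined \<open>T\<close>).\<close>
definition modulus :: "'a ell2 set \<Rightarrow> 'a oper \<Rightarrow> 'a oper"
  where "modulus H T = (THE A. positive_selfadjoint H A \<and> A O A = T O adjoint_in H T)"

definition initial_space :: "'a ell2 set \<Rightarrow> 'a oper \<Rightarrow> 'a ell2 set"
  where "initial_space H U = H \<ominus> op_kernel U"

definition partial_isometry :: "'a ell2 set \<Rightarrow> 'a oper \<Rightarrow> bool"
  where "partial_isometry H U \<longleftrightarrow>
    linear_operator H U \<and> Domain U = H \<and> (\<exists>c. \<forall>(f, f')\<in>U. norm f' \<le> c * norm f) \<and>
    (\<forall>(f, f')\<in>U. f \<in> initial_space H U \<longrightarrow> norm f' = norm f)"

text \<open>The factor \<open>U\<close> of the polar decomposition \<open>T = U |T|\<close>: the unique partial isometry with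
  this product and with initial space the closure of the range of \<open>|T|\<close>.\<close>
definition polar_isometry :: "'a ell2 set \<Rightarrow> 'a oper \<Rightarrow> 'a oper"
  where "polar_isometry H T = (THE U. partial_isometry H U \<and>
    initial_space H U = closure (Range (modulus H T)) \<and> T = modulus H T O U)"

subsection \<open>Directed trees\<close>

definition is_root :: "'a set \<Rightarrow> ('a \<times> 'a) set \<Rightarrow> 'a \<Rightarrow> bool"
  where "is_root V E v \<longleftrightarrow> v \<in> V \<and> (\<nexists>u. (u, v) \<in> E)"

definition directed_tree :: "'a set \<Rightarrow> ('a \<times> 'a) set \<Rightarrow> bool"
  where "directed_tree V E \<longleftrightarrow>
    V \<noteq> {} \<and> E \<subseteq> V \<times> V - {(v, v) | v. v \<in> V} \<and>
    (\<forall>u\<in>V. \<forall>v\<in>V. u \<noteq> v \<longrightarrow>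
      (\<exists>p. length p \<ge> 2 \<and> set p \<subseteq> V \<and> hd p = u \<and> last p = v \<and>
           successively (\<lambda>x y. (x, y) \<in> E \<or> (y, x) \<in> E) p)) \<and>
    (\<nexists>c. length c \<ge> 2 \<and> distinct c \<and> successively (\<lambda>x y. (x, y) \<in> E) c \<and> (last c, hd c) \<in> E) \<and>
    (\<forall>v\<in>V. \<not> is_root V E v \<longrightarrow> (\<exists>!u. (u, v) \<in> E))"

definition tree_root :: "'a set \<Rightarrow> ('a \<times> 'a) set \<Rightarrow> 'a"
  where "tree_root V E = (THE v. is_root V E v)"

definition nonroots :: "'a set \<Rightarrow> ('a \<times> 'a) set \<Rightarrow> 'a set"
  where "nonroots V E = {v \<in> V. \<not> is_root V E v}"

definition parent :: "('a \<times> 'a) set \<Rightarrow> 'a \<Rightarrow> 'a"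
  where "parent E v = (THE u. (u, v) \<in> E)"

definition children :: "('a \<times> 'a) set \<Rightarrow> 'a \<Rightarrow> 'a set"
  where "children E u = {v. (u, v) \<in> E}"

definition nonleaves :: "'a set \<Rightarrow> ('a \<times> 'a) set \<Rightarrow> 'a set"
  where "nonleaves V E = {u \<in> V. children E u \<noteq> {}}"

subsection \<open>Weighted shifts\<close>

text \<open>Weights are total functions whose values off \<^term>\<open>nonroots V E\<close> are ignored.\<close>
definition shift_fun ::
    "'a set \<Rightarrow> ('a \<times> 'a) set \<Rightarrow> ('a \<Rightarrow> complex) \<Rightarrow> ('a \<Rightarrow> complex) \<Rightarrow> ('a \<Rightarrow> complex)"
  where "shift_fun V E lam f = (\<lambda>v. if v \<in> nonroots V E then lam v * f (parent E v) else 0)"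

text \<open>Since the second component ranges over \<^typ>\<open>'a ell2\<close>, the domain consists exactly of those
  \<open>f\<close> for which \<^term>\<open>shift_fun V E lam (ell2_fun f)\<close> is square summable.\<close>
definition weighted_shift :: "'a set \<Rightarrow> ('a \<times> 'a) set \<Rightarrow> ('a \<Rightarrow> complex) \<Rightarrow> 'a oper"
  where "weighted_shift V E lam =
    {(f, g). f \<in> ell2_on V \<and> g \<in> ell2_on V \<and> ell2_fun g = shift_fun V E lam (ell2_fun f)}"

text \<open>The vector \<open>\<lambda>\<^sup>u\<close>, extended by zero off the children of \<open>u\<close>; meaningful only if the weights
  are square summable there.\<close>
definition weight_vec :: "('a \<times> 'a) set \<Rightarrow> ('a \<Rightarrow> complex) \<Rightarrow> 'a \<Rightarrow> 'a ell2"
  where "weight_vec E lam u = Abs_ell2 (\<lambda>v. if v \<in> children E u then lam v else 0)"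

end

(* Since the children sets are pairwise disjoint, everything decomposes along them: the restriction
   of S f to Chi(u) is f(u) lambda^u, so S^* S is the square of the diagonal operator D with elements
   |S e_u|.  If A is positive selfadjoint with A^2 = D^2, then A e_u = |S e_u| e_u for all u, whence
   A is contained in D, and selfadjointness gives A = D.  The shift with weights pi has vectors pi^u
   that are unit or zero, which makes it a partial isometry with S = S_pi D.  A partial isometry is
   determined by its values on the e_u, and it kills e_w for w outside V^+ because each coordinate
   functional of a bounded operator is represented by a vector orthogonal to the kernel. *)

theory Submission
  imports Defs
begin

text \<open>Both \<open>modulus\<close> and \<open>polar_isometry\<close> are descriptions by
  \<open>THE\<close>, so each identification needs existence and uniqueness, and for unbounded
  operators every equality is also an equality of domains. The domains of S and D agree because the
  squared norm of S f is the sum of the numbers |S e_u|^2 |f(u)|^2. No spectral theorem is involved: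
  uniqueness of the square root is needed only for the square of a diagonal operator, where the
  basis vectors are eigenvectors. The delicate point about U is that its kernel is prescribed only
  through the orthogonal complement; getting e_w back into the kernel is half of the double
  complement identity, and the representing vectors are built coordinate by coordinate for this
  purpose. Facts on shifts are stated for any weights that are square summable on each set of
  children, so that they apply to lambda and to pi alike.\<close>

lemmas ell2_rep_eq [simp] =
  zero_ell2.rep_eq plus_ell2.rep_eq uminus_ell2.rep_eq minus_ell2.rep_eq scaleC.rep_eq

lemma ell2_fun_basis_vec [simp]: "ell2_fun (basis_vec u) v = (if v = u then 1 else 0)"
  by (simp add: basis_vec.rep_eq indicator_def)

section \<open>Complex inner product, coordinates and norm on \<open>ell2\<close>\<close>

lemma norm_ell2_power2: "(norm f)\<^sup>2 = (\<Sum>\<^sub>\<infinity>x. (cmod (ell2_fun f x))\<^sup>2)"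
  by (simp add: norm_ell2_def infsum_nonneg)

lemma has_sum_norm_power2: "((\<lambda>x. (cmod (ell2_fun f x))\<^sup>2) has_sum (norm f)\<^sup>2) UNIV"
  unfolding norm_ell2_power2 by (rule has_sum_infsum[OF ell2_summable])

lemma has_sum_cinner: "((\<lambda>x. ell2_fun f x * cnj (ell2_fun g x)) has_sum cinner f g) UNIV"
  unfolding cinner_def by (rule has_sum_infsum[OF cinner_summable])

lemma cinner_self_norm: "cinner f f = complex_of_real ((norm f)\<^sup>2)"
  by (simp add: cinner_self norm_ell2_power2)

lemma cinner_scaleC_right: "cinner f (c *\<^sub>C g) = cnj c * cinner f g"
  by (metis cinner_scaleC_left cinner_cnj complex_cnj_mult)

lemma cinner_zero_left [simp]: "cinner 0 g = 0"
  by (simp add: cinner_def)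

lemma cinner_zero_right [simp]: "cinner g 0 = 0"
  by (simp add: cinner_def)

lemma cinner_basis_vec_right [simp]: "cinner f (basis_vec u) = ell2_fun f u"
proof -
  have "((\<lambda>x. ell2_fun f x * cnj (ell2_fun (basis_vec u) x)) has_sum ell2_fun f u) {u}"
    by (rule has_sum_finiteI) auto
  hence "((\<lambda>x. ell2_fun f x * cnj (ell2_fun (basis_vec u) x)) has_sum ell2_fun f u) UNIV"
    by (rule has_sum_cong_neutral[THEN iffD1, rotated -1]) auto
  thus ?thesis
    using has_sum_cinner has_sum_unique by blast
qed

lemma cinner_basis_vec_left [simp]: "cinner (basis_vec u) f = cnj (ell2_fun f u)"
  by (subst cinner_cnj) simp

text \<open>The class instance gives homogeneity of the norm for real scalars only; complex scalars
  are reached through \<open>cinner\<close>, where the factor becomes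
  \<open>c * cnj c\<close>.\<close>

lemma norm_scaleC: "norm (c *\<^sub>C f) = cmod c * norm (f :: 'a ell2)"
proof -
  have "complex_of_real ((norm (c *\<^sub>C f))\<^sup>2) = (c * cnj c) * cinner f f"
    unfolding cinner_self_norm[symmetric] cinner_scaleC_left cinner_scaleC_right by (simp only: mult_ac)
  also have "\<dots> = complex_of_real ((cmod c * norm f)\<^sup>2)"
    unfolding cinner_self_norm complex_norm_square[symmetric] power_mult_distrib of_real_mult ..
  finally have "complex_of_real ((norm (c *\<^sub>C f))\<^sup>2) = complex_of_real ((cmod c * norm f)\<^sup>2)" .
  hence "(norm (c *\<^sub>C f))\<^sup>2 = (cmod c * norm f)\<^sup>2"
    by (simp only: of_real_eq_iff)
  thus ?thesis by (rule power2_eq_imp_eq) auto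
qed

text \<open>A unimodular factor on f makes the inner product real and nonnegative, so that it equals
  the real \<open>inner\<close>, for which Cauchy-Schwarz is available.\<close>

lemma cmod_cinner_le: "cmod (cinner f g) \<le> norm f * norm g"
proof (cases "cinner f g = 0")
  case False
  define c where "c = cnj (cinner f g) / complex_of_real (cmod (cinner f g))"
  have c: "cmod c = 1" using False by (simp add: c_def norm_divide)
  have "cinner (c *\<^sub>C f) g = (cinner f g * cnj (cinner f g)) / complex_of_real (cmod (cinner f g))"
    by (simp add: c_def cinner_scaleC_left)
  also have "\<dots> = complex_of_real (cmod (cinner f g))"
    unfolding complex_norm_square[symmetric] by (simp add: power2_eq_square)
  finally have "cinner (c *\<^sub>C f) g = complex_of_real (cmod (cinner f g))" .
  hence "cmod (cinner f g) = inner (c *\<^sub>C f) g"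
    by (simp add: inner_ell2_def)
  also have "\<dots> \<le> norm (c *\<^sub>C f) * norm g" by (rule norm_cauchy_schwarz)
  finally show ?thesis by (simp add: norm_scaleC c)
qed simp

lemma bounded_linear_ell2_fun: "bounded_linear (\<lambda>f. ell2_fun f x)"
  by (rule bounded_linear_intro[where K = 1])
    (use cmod_ell2_fun_le_norm[of _ x] in \<open>auto simp: scaleR_scaleC scaleR_conv_of_real\<close>)

lemma bounded_linear_cinner_left: "bounded_linear (\<lambda>f. cinner f g)"
  by (rule bounded_linear_intro[where K = "norm g"])
    (auto simp: scaleR_scaleC scaleR_conv_of_real cinner_add_left cinner_scaleC_left cmod_cinner_le)

lemma bounded_linear_scaleC_left: "bounded_linear (\<lambda>c. c *\<^sub>C (f :: 'a ell2))"
  by (rule bounded_linear_intro[where K = "norm f"])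
    (auto simp: scaleR_scaleC scaleR_conv_of_real cvec.scale_left_distrib norm_scaleC)

lemma bounded_linear_scaleC_right: "bounded_linear (\<lambda>f. c *\<^sub>C (f :: 'a ell2))"
  by (rule bounded_linear_intro[where K = "cmod c"])
    (auto simp: scaleR_scaleC cvec.scale_right_distrib norm_scaleC mult.commute)

section \<open>Restriction to a set of indices, and sums over disjoint supports\<close>

lemma square_summable_restrict:
  fixes f :: "'a \<Rightarrow> complex"
  shows "(\<lambda>x. (cmod (if x \<in> A then f x else 0))\<^sup>2) summable_on UNIV \<longleftrightarrow>
    (\<lambda>x. (cmod (f x))\<^sup>2) summable_on A"
  by (rule summable_on_cong_neutral) auto

text \<open>This is the orthogonal projection onto \<open>ell2_on A\<close>; being bounded and
  linear, it passes through infinite sums.\<close>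

lift_definition restr :: "'a set \<Rightarrow> 'a ell2 \<Rightarrow> 'a ell2" is "\<lambda>A f x. if x \<in> A then f x else 0"
  unfolding square_summable_restrict by (erule summable_on_subset_banach) simp

lemma ell2_fun_restr [simp]: "ell2_fun (restr A f) x = (if x \<in> A then ell2_fun f x else 0)"
  by (simp add: restr.rep_eq)

lemma has_sum_norm_restr_power2:
  "((\<lambda>x. (cmod (ell2_fun f x))\<^sup>2) has_sum (norm (restr A f))\<^sup>2) A"
  by (rule has_sum_cong_neutral[THEN iffD1, rotated -1, OF has_sum_norm_power2]) auto

lemma has_sum_cinner_restr:
  "((\<lambda>x. ell2_fun f x * cnj (ell2_fun g x)) has_sum cinner (restr A f) g) A"
  by (rule has_sum_cong_neutral[THEN iffD1, rotated -1, OF has_sum_cinner]) auto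

text \<open>A finite F carries the squared norm of f up to e^2/2, and a set that misses F can carry
  only the rest. The bound is uniform in B, as unconditional convergence requires.\<close>

lemma norm_restr_le_outside:
  assumes "e > 0"
  shows "\<exists>F. finite F \<and> (\<forall>B. B \<inter> F = {} \<longrightarrow> norm (restr B f) < e)"
proof -
  have "\<exists>F. finite F \<and> F \<subseteq> UNIV \<and>
      dist (\<Sum>x\<in>F. (cmod (ell2_fun f x))\<^sup>2) ((norm f)\<^sup>2) \<le> e\<^sup>2 / 2"
    by (rule has_sum_finite_approximation[OF has_sum_norm_power2]) (use assms in auto)
  then obtain F where F: "finite F"
    "(norm f)\<^sup>2 - (\<Sum>x\<in>F. (cmod (ell2_fun f x))\<^sup>2) \<le> e\<^sup>2 / 2"
    unfolding dist_real_def by (metis abs_minus_commute abs_le_D1)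
  have "norm (restr B f) < e" if B: "B \<inter> F = {}" for B
  proof -
    have 1: "((\<lambda>x. (cmod (ell2_fun f x))\<^sup>2) has_sum
        (norm (restr B f))\<^sup>2 + (\<Sum>x\<in>F. (cmod (ell2_fun f x))\<^sup>2)) (B \<union> F)"
      by (rule has_sum_Un_disjoint[OF has_sum_norm_restr_power2 has_sum_finite[OF F(1)] B])
    have "(norm (restr B f))\<^sup>2 + (\<Sum>x\<in>F. (cmod (ell2_fun f x))\<^sup>2) \<le> (norm f)\<^sup>2"
      by (rule has_sum_mono2[OF 1 has_sum_norm_power2]) auto
    moreover have "e\<^sup>2 / 2 < e\<^sup>2" using assms by simp
    ultimately have "(norm (restr B f))\<^sup>2 < e\<^sup>2" using F(2) by linarith
    thus ?thesis using assms by (meson less_eq_real_def power2_less_imp_less)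
  qed
  thus ?thesis using F(1) by blast
qed

lemma norm_restr_le: "norm (restr A f) \<le> norm f"
proof -
  have "(norm (restr A f))\<^sup>2 \<le> (norm f)\<^sup>2"
    by (rule has_sum_mono2[OF has_sum_norm_restr_power2 has_sum_norm_power2]) auto
  thus ?thesis by (simp add: power2_le_iff_abs_le)
qed

lemma bounded_linear_restr: "bounded_linear (restr A)"
  by (rule bounded_linear_intro[where K = 1])
    (auto intro!: ell2_eqI simp: scaleR_scaleC norm_restr_le)

lemma ell2_fun_sum [simp]: "ell2_fun (\<Sum>i\<in>F. f i) x = (\<Sum>i\<in>F. ell2_fun (f i) x)"
  using bounded_linear.linear[OF bounded_linear_ell2_fun] by (rule linear_sum)

text \<open>By disjointness each point of F lies in at most one \<open>A i\<close>, so only finitely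
  many \<open>A i\<close> meet the F of the tail estimate. Once these indices are included, the
  error is the restriction of f to a set that misses F.\<close>

lemma has_sum_restr:
  assumes disj: "disjoint_family_on A I"
  shows "((\<lambda>i. restr (A i) f) has_sum restr (\<Union>i\<in>I. A i) f) I"
  unfolding has_sum_def tendsto_iff eventually_finite_subsets_at_top
proof (intro allI impI)
  fix e :: real assume "e > 0"
  then obtain F where F: "finite F" "\<And>B. B \<inter> F = {} \<Longrightarrow> norm (restr B f) < e"
    using norm_restr_le_outside by metis
  define X where "X = {i \<in> I. A i \<inter> F \<noteq> {}}"
  have "\<exists>i. X \<inter> {i. x \<in> A i} \<subseteq> {i}" for x
    using disj unfolding X_def disjoint_family_on_def by blast
  hence "finite (\<Union>x\<in>F. X \<inter> {i. x \<in> A i})"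
    using F(1) by (meson finite.simps finite_UN finite_subset)
  moreover have "X = (\<Union>x\<in>F. X \<inter> {i. x \<in> A i})" by (auto simp: X_def)
  ultimately have "finite X" by simp
  moreover have "dist (\<Sum>i\<in>Y. restr (A i) f) (restr (\<Union>i\<in>I. A i) f) < e"
    if Y: "finite Y" "X \<subseteq> Y" "Y \<subseteq> I" for Y
  proof -
    have "(\<Sum>i\<in>Y. ell2_fun (restr (A i) f) x) = (if x \<in> (\<Union>i\<in>Y. A i) then ell2_fun f x else 0)" for x
    proof (cases "x \<in> (\<Union>i\<in>Y. A i)")
      case True
      then obtain j where j: "j \<in> Y" "x \<in> A j" by blast
      have "x \<in> A i \<longleftrightarrow> i = j" if "i \<in> Y" for i
        using disj j that Y(3) unfolding disjoint_family_on_def by blast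
      hence "(\<Sum>i\<in>Y. ell2_fun (restr (A i) f) x) = (\<Sum>i\<in>Y. if i = j then ell2_fun f x else 0)"
        by (intro sum.cong) auto
      thus ?thesis using j Y(1) by auto
    qed (auto intro: sum.neutral)
    hence "restr (\<Union>i\<in>I. A i) f - (\<Sum>i\<in>Y. restr (A i) f) = restr ((\<Union>i\<in>I. A i) - (\<Union>i\<in>Y. A i)) f"
      using Y(3) by (intro ell2_eqI) auto
    moreover have "((\<Union>i\<in>I. A i) - (\<Union>i\<in>Y. A i)) \<inter> F = {}"
      using Y(2) by (auto simp: X_def)
    ultimately show ?thesis
      using F(2) by (metis dist_commute dist_norm)
  qed
  ultimately show "\<exists>X. finite X \<and> X \<subseteq> I \<and> (\<forall>Y. finite Y \<and> X \<subseteq> Y \<and> Y \<subseteq> I \<longrightarrow>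
      dist (\<Sum>i\<in>Y. restr (A i) f) (restr (\<Union>i\<in>I. A i) f) < e)"
    unfolding X_def by (intro exI[of _ X]) (auto simp: X_def)
qed

lemma restr_eq_self: "f \<in> ell2_on A \<Longrightarrow> restr A f = f"
  by (intro ell2_eqI) (auto simp: ell2_on_def)

lemma has_sum_basis_vec:
  assumes "f \<in> ell2_on W"
  shows "((\<lambda>u. ell2_fun f u *\<^sub>C basis_vec u) has_sum f) W"
proof -
  have "((\<lambda>u. restr {u} f) has_sum restr (\<Union>u\<in>W. {u}) f) W"
    by (rule has_sum_restr) (auto simp: disjoint_family_on_def)
  moreover have "restr {u} f = ell2_fun f u *\<^sub>C basis_vec u" for u
    by (intro ell2_eqI) auto
  ultimately show ?thesis using assms by (simp add: restr_eq_self)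
qed

section \<open>Closed subspaces given by a support or by one vector\<close>

lemma subspace_ell2_on: "cvec.subspace (ell2_on W)"
  by (auto simp: cvec.subspace_def ell2_on_def)

lemma closed_ell2_on: "closed (ell2_on W)"
proof -
  have "ell2_on W = (\<Inter>v\<in>-W. {f. ell2_fun f v = 0})" by (auto simp: ell2_on_def)
  moreover have "closed {f. ell2_fun f v = 0}" for v :: 'a
    by (intro closed_Collect_eq linear_continuous_on[OF bounded_linear_ell2_fun] continuous_on_const)
  ultimately show ?thesis by auto
qed

lemma has_sum_in_closure:
  assumes "(g has_sum f) I" "\<And>F. finite F \<Longrightarrow> F \<subseteq> I \<Longrightarrow> sum g F \<in> M"
  shows "f \<in> closure M"
proof (rule Lim_in_closed_set)
  show "(sum g \<longlongrightarrow> f) (finite_subsets_at_top I)" using assms(1) by (simp add: has_sum_def)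
  show "\<forall>\<^sub>F F in finite_subsets_at_top I. sum g F \<in> closure M"
    unfolding eventually_finite_subsets_at_top
    by (intro exI[of _ "{}"]) (simp add: assms(2) closure_subset[THEN subsetD])
qed simp_all

text \<open>The finite partial sums of the basis expansion of an element of \<open>ell2_on W\<close>
  lie in M. This criterion settles the density of diagonal domains and the closures of the ranges of
  diagonal operators and of the adjoint.\<close>

lemma closure_subspace_eq_ell2_on:
  assumes "cvec.subspace M" "M \<subseteq> ell2_on W" "\<And>u. u \<in> W \<Longrightarrow> basis_vec u \<in> M"
  shows "closure M = ell2_on W"
proof
  show "closure M \<subseteq> ell2_on W" using assms(2) closed_ell2_on by (rule closure_minimal)
  show "ell2_on W \<subseteq> closure M"
  proof
    fix f assume "f \<in> ell2_on W"
    from has_sum_basis_vec[OF this] show "f \<in> closure M"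
    proof (rule has_sum_in_closure)
      fix F assume "F \<subseteq> W"
      thus "(\<Sum>u\<in>F. ell2_fun f u *\<^sub>C basis_vec u) \<in> M"
        by (intro cvec.subspace_sum[OF assms(1)] cvec.subspace_scale[OF assms(1)] assms(3)) blast
    qed
  qed
qed

lemma orthonormal_basis_basis_vec: "orthonormal_basis (ell2_on V) V basis_vec"
  unfolding orthonormal_basis_def
proof
  show "closure (cvec.span (basis_vec ` V)) = ell2_on V"
  proof (rule closure_subspace_eq_ell2_on)
    show "cvec.span (basis_vec ` V) \<subseteq> ell2_on V"
      by (rule cvec.span_minimal) (auto simp: subspace_ell2_on, auto simp: ell2_on_def)
  qed (auto intro: cvec.span_base)
qed auto

text \<open>For w \<noteq> 0 the line is the set where two continuous maps agree: f multiplied by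
  the squared norm of w, and w multiplied by \<open>cinner f w\<close>.\<close>

lemma closed_span_singleton: "closed (cvec.span {w :: 'a ell2})"
proof (cases "w = 0")
  case False
  have "cvec.span {w} = {f. cinner f w *\<^sub>C w = cinner w w *\<^sub>C f}"
  proof (intro equalityI subsetI)
    fix f assume "f \<in> {f. cinner f w *\<^sub>C w = cinner w w *\<^sub>C f}"
    hence "(1 / cinner w w) *\<^sub>C (cinner f w *\<^sub>C w) = (1 / cinner w w) *\<^sub>C (cinner w w *\<^sub>C f)"
      by simp
    hence "f = (cinner f w / cinner w w) *\<^sub>C w"
      using False by (simp add: cinner_self_norm)
    thus "f \<in> cvec.span {w}" by (metis cvec.span_base cvec.span_scale singletonI)
  qed (auto simp: cvec.span_singleton cinner_scaleC_left mult.commute)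
  moreover have "closed {f. cinner f w *\<^sub>C w = cinner w w *\<^sub>C f}"
    by (rule closed_Collect_eq[OF linear_continuous_on[OF bounded_linear_compose[OF
          bounded_linear_scaleC_left bounded_linear_cinner_left]]
          linear_continuous_on[OF bounded_linear_scaleC_right]])
  ultimately show ?thesis by simp
qed (simp add: cvec.span_singleton)

section \<open>Hilbert sums of subspaces with disjoint supports\<close>

lemma cinner_eq_0_disjoint:
  assumes "f \<in> ell2_on A" "g \<in> ell2_on B" "A \<inter> B = {}"
  shows "cinner f g = 0"
proof -
  have "ell2_fun f x * cnj (ell2_fun g x) = 0" for x
    using assms by (auto simp: ell2_on_def)
  thus ?thesis unfolding cinner_def by (simp only: infsum_0)
qed

lemma orthogonal_family_disjoint:
  assumes "disjoint_family_on A I" "\<And>i. i \<in> I \<Longrightarrow> M i \<subseteq> ell2_on (A i)"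
  shows "orthogonal_family I M"
  using assms unfolding orthogonal_family_def orthogonal_sets_def disjoint_family_on_def
  by (meson cinner_eq_0_disjoint subsetD)

text \<open>The summands of f are forced: the continuous map \<open>restr (A i)\<close>, applied to
  the sum, annihilates every block but the i-th. Membership becomes a condition on each block, with
  no series left in it.\<close>

lemma hilbert_sum_disjoint:
  assumes disj: "disjoint_family_on A I" and M: "\<And>i. i \<in> I \<Longrightarrow> M i \<subseteq> ell2_on (A i)"
  shows "hilbert_sum I M = {f \<in> ell2_on (\<Union>i\<in>I. A i). \<forall>i\<in>I. restr (A i) f \<in> M i}"
proof (intro equalityI subsetI)
  fix f assume "f \<in> {f \<in> ell2_on (\<Union>i\<in>I. A i). \<forall>i\<in>I. restr (A i) f \<in> M i}"
  thus "f \<in> hilbert_sum I M"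
    unfolding hilbert_sum_def using has_sum_restr[OF disj, of f]
    by (auto simp: restr_eq_self intro!: exI[of _ "\<lambda>i. restr (A i) f"])
next
  fix f assume "f \<in> hilbert_sum I M"
  then obtain g where g: "\<And>i. i \<in> I \<Longrightarrow> g i \<in> M i" "(g has_sum f) I"
    by (auto simp: hilbert_sum_def)
  have gA: "g i \<in> ell2_on (A i)" if "i \<in> I" for i using g M that by blast
  have "f \<in> closure (ell2_on (\<Union>i\<in>I. A i))"
  proof (rule has_sum_in_closure[OF g(2)])
    fix F assume "finite F" "F \<subseteq> I"
    thus "sum g F \<in> ell2_on (\<Union>i\<in>I. A i)"
      by (intro cvec.subspace_sum[OF subspace_ell2_on]) (use gA in \<open>auto simp: ell2_on_def\<close>)
  qed
  moreover have "restr (A i) f \<in> M i" if i: "i \<in> I" for i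
  proof -
    have "((\<lambda>j. restr (A i) (g j)) has_sum restr (A i) f) I"
      using has_sum_bounded_linear[OF bounded_linear_restr g(2)] by (simp add: o_def)
    moreover have "restr (A i) (g j) = (if j = i then g i else 0)" if "j \<in> I" for j
    proof (intro ell2_eqI)
      fix x
      show "ell2_fun (restr (A i) (g j)) x = ell2_fun (if j = i then g i else 0) x"
        using gA[OF that] gA[OF i] disj i that
        by (auto simp: ell2_on_def disjoint_family_on_def disjoint_iff)
    qed
    ultimately have "((\<lambda>j. if j = i then g i else 0) has_sum restr (A i) f) I"
      by (simp cong: has_sum_cong)
    moreover have "((\<lambda>j. if j = i then g i else 0) has_sum g i) I"
      by (rule has_sum_finite_neutralI[of "{i}"]) (use i in auto)
    ultimately have "restr (A i) f = g i" by (rule has_sum_unique)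
    thus ?thesis using g i by simp
  qed
  ultimately show "f \<in> {f \<in> ell2_on (\<Union>i\<in>I. A i). \<forall>i\<in>I. restr (A i) f \<in> M i}"
    by (simp add: closure_closed[OF closed_ell2_on])
qed

lemma closed_hilbert_sum_disjoint:
  assumes "disjoint_family_on A I" "\<And>i. i \<in> I \<Longrightarrow> M i \<subseteq> ell2_on (A i)"
    and "\<And>i. i \<in> I \<Longrightarrow> closed (M i)"
  shows "closed (hilbert_sum I M)"
proof -
  have "hilbert_sum I M = ell2_on (\<Union>i\<in>I. A i) \<inter> (\<Inter>i\<in>I. restr (A i) -` M i)"
    by (subst hilbert_sum_disjoint[OF assms(1,2)]) auto
  moreover have "closed (restr (A i) -` M i)" if "i \<in> I" for i
    using assms(3)[OF that] linear_continuous_on[OF bounded_linear_restr]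
    by (intro closed_vimage) auto
  hence "closed (\<Inter>i\<in>I. restr (A i) -` M i)" by (intro closed_INT) blast
  ultimately show ?thesis by (simp only: closed_Int closed_ell2_on)
qed

section \<open>Operators given by graphs\<close>

lemma linear_operatorD:
  assumes "linear_operator H T"
  shows "(f, f') \<in> T \<Longrightarrow> (g, g') \<in> T \<Longrightarrow> (f + g, f' + g') \<in> T"
    and "(f, f') \<in> T \<Longrightarrow> (c *\<^sub>C f, c *\<^sub>C f') \<in> T"
    and "(0, 0) \<in> T"
    and "(f, f') \<in> T \<Longrightarrow> (f, f'') \<in> T \<Longrightarrow> f' = f''"
    and "(f, f') \<in> T \<Longrightarrow> f \<in> H"
    and "(f, f') \<in> T \<Longrightarrow> f' \<in> H"
  using assms unfolding linear_operator_def by (blast dest: single_valuedD)+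

lemma linear_operator_diff:
  assumes "linear_operator H T" "(f, f') \<in> T" "(g, g') \<in> T"
  shows "(f - g, f' - g') \<in> T"
  using linear_operatorD(1)[OF assms(1,2) linear_operatorD(2)[OF assms(1,3), of "-1"]]
  by (simp add: cvec.scale_minus_left)

lemma subspace_Range:
  assumes "linear_operator H T"
  shows "cvec.subspace (Range T)"
  unfolding cvec.subspace_def using linear_operatorD(1-3)[OF assms] by blast

lemma app_eqI:
  assumes "linear_operator H T" "(f, g) \<in> T"
  shows "T \<cdot> f = g"
  unfolding app_def using linear_operatorD(4)[OF assms(1)] assms(2) by blast

section \<open>Diagonal operators\<close>

text \<open>The domain is maximal: as g ranges over \<open>ell2\<close>, it contains every f in
  \<open>ell2_on V\<close> whose product with t is square summable on V. A proper restriction would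
  not be selfadjoint.\<close>

definition diag :: "'a set \<Rightarrow> ('a \<Rightarrow> real) \<Rightarrow> 'a oper"
  where "diag V t = {(f, g). f \<in> ell2_on V \<and> g \<in> ell2_on V \<and>
    (\<forall>u\<in>V. ell2_fun g u = complex_of_real (t u) * ell2_fun f u)}"

lemma diagI:
  assumes "f \<in> ell2_on V" "g \<in> ell2_on V"
    and "\<And>u. u \<in> V \<Longrightarrow> ell2_fun g u = complex_of_real (t u) * ell2_fun f u"
  shows "(f, g) \<in> diag V t"
  using assms by (simp add: diag_def)

lemma ell2_on_eqI:
  assumes "f \<in> ell2_on V" "g \<in> ell2_on V" "\<And>u. u \<in> V \<Longrightarrow> ell2_fun f u = ell2_fun g u"
  shows "f = g"
proof (rule ell2_eqI)
  fix u show "ell2_fun f u = ell2_fun g u"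
    using assms by (cases "u \<in> V") (auto simp: ell2_on_def)
qed

lemma linear_operator_diag: "linear_operator (ell2_on V) (diag V t)"
proof -
  have "single_valued (diag V t)"
    by (auto simp: single_valued_def diag_def intro: ell2_on_eqI)
  thus ?thesis
    by (auto simp: linear_operator_def diag_def ell2_on_def algebra_simps)
qed

lemma basis_vec_in_diag: "u \<in> V \<Longrightarrow> (basis_vec u, t u *\<^sub>R basis_vec u) \<in> diag V t"
  by (auto simp: diag_def ell2_on_def scaleR_scaleC)

lemma adjoint_diag: "adjoint_in (ell2_on V) (diag V t) = diag V t"
proof (intro equalityI subrelI)
  fix g h assume gh: "(g, h) \<in> adjoint_in (ell2_on V) (diag V t)"
  have "ell2_fun h u = complex_of_real (t u) * ell2_fun g u" if "u \<in> V" for u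
  proof -
    have "cinner (t u *\<^sub>R basis_vec u) g = cinner (basis_vec u) h"
      using gh basis_vec_in_diag[OF that] unfolding adjoint_in_def by blast
    hence "cnj (complex_of_real (t u) * cnj (ell2_fun g u)) = cnj (cnj (ell2_fun h u))"
      by (simp add: scaleR_scaleC cinner_scaleC_left)
    thus ?thesis by simp
  qed
  thus "(g, h) \<in> diag V t" using gh by (auto simp: adjoint_in_def intro: diagI)
next
  fix g h assume gh: "(g, h) \<in> diag V t"
  have "cinner f' g = cinner f h" if "(f, f') \<in> diag V t" for f f'
  proof -
    have "ell2_fun f' u * cnj (ell2_fun g u) = ell2_fun f u * cnj (ell2_fun h u)" for u
      using that gh by (cases "u \<in> V") (auto simp: diag_def ell2_on_def)
    thus ?thesis by (simp add: cinner_def)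
  qed
  thus "(g, h) \<in> adjoint_in (ell2_on V) (diag V t)"
    using gh by (auto simp: adjoint_in_def diag_def)
qed

lemma positive_selfadjoint_diag:
  assumes "\<And>u. u \<in> V \<Longrightarrow> 0 \<le> t u"
  shows "positive_selfadjoint (ell2_on V) (diag V t)"
  unfolding positive_selfadjoint_def
proof (intro conjI ballI)
  show "densely_defined (ell2_on V) (diag V t)"
    unfolding densely_defined_def
  proof (rule eq_refl[OF sym], rule closure_subspace_eq_ell2_on)
    show "cvec.subspace (Domain (diag V t))"
      unfolding cvec.subspace_def using linear_operatorD(1-3)[OF linear_operator_diag] by blast
    show "Domain (diag V t) \<subseteq> ell2_on V" by (auto simp: diag_def)
    show "basis_vec u \<in> Domain (diag V t)" if "u \<in> V" for u
      using basis_vec_in_diag[OF that] by blast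
  qed
next
  fix p assume "p \<in> diag V t"
  then obtain f f' where p: "p = (f, f')" and ff': "(f, f') \<in> diag V t" by (cases p) auto
  have eq: "ell2_fun f' u * cnj (ell2_fun f u) =
      complex_of_real ((if u \<in> V then t u else 0) * (cmod (ell2_fun f u))\<^sup>2)" for u
  proof (cases "u \<in> V")
    case True
    hence "ell2_fun f' u * cnj (ell2_fun f u) = complex_of_real (t u) * (ell2_fun f u * cnj (ell2_fun f u))"
      using ff' by (simp add: diag_def)
    also have "\<dots> = complex_of_real (t u * (cmod (ell2_fun f u))\<^sup>2)"
      unfolding complex_norm_square[symmetric] of_real_mult ..
    finally show ?thesis using True by simp
  qed (use ff' in \<open>auto simp: diag_def ell2_on_def\<close>)
  \<comment> \<open>Every term is real and nonnegative; \<open>Re\<close> and \<open>Im\<close> are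
    bounded linear and carry this over to the infinite sum.\<close>
  have hs: "((\<lambda>u. complex_of_real ((if u \<in> V then t u else 0) * (cmod (ell2_fun f u))\<^sup>2))
      has_sum cinner f' f) UNIV"
    using has_sum_cinner[of f' f] unfolding eq .
  have "((\<lambda>u. (if u \<in> V then t u else 0) * (cmod (ell2_fun f u))\<^sup>2) has_sum Re (cinner f' f)) UNIV"
    using has_sum_bounded_linear[OF bounded_linear_Re hs] by (simp only: o_def Re_complex_of_real)
  hence "0 \<le> Re (cinner f' f)"
    by (rule has_sum_nonneg) (use assms in auto)
  moreover have "((\<lambda>u::'a. 0) has_sum Im (cinner f' f)) UNIV"
    using has_sum_bounded_linear[OF bounded_linear_Im hs] by (simp only: o_def Im_complex_of_real)
  hence "Im (cinner f' f) = 0"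
    by (rule has_sum_unique) (simp add: has_sum_0)
  ultimately show "case p of (f, f') \<Rightarrow> cinner f' f \<in> \<real>\<^sub>\<ge>\<^sub>0"
    by (simp add: p complex_nonneg_Reals_iff)
qed (rule linear_operator_diag adjoint_diag)+

section \<open>Uniqueness of the positive square root of a squared diagonal operator\<close>

text \<open>Testing the adjoint condition for a pair of A on the eigenvectors
  \<open>basis_vec u\<close> yields every coordinate of the image, so A is contained in the diagonal
  operator. Passing to adjoints reverses this inclusion and changes neither operator.\<close>

lemma selfadjoint_eq_diag:
  assumes A: "adjoint_in (ell2_on V) A = A"
    and basis: "\<And>u. u \<in> V \<Longrightarrow> (basis_vec u, t u *\<^sub>R basis_vec u) \<in> A"
  shows "A = diag V t"
proof
  show sub: "A \<subseteq> diag V t"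
  proof (rule subrelI)
    fix f g assume "(f, g) \<in> A"
    hence fg: "(f, g) \<in> adjoint_in (ell2_on V) A" by (simp add: A)
    have "ell2_fun g u = complex_of_real (t u) * ell2_fun f u" if "u \<in> V" for u
    proof -
      have "cinner (t u *\<^sub>R basis_vec u) f = cinner (basis_vec u) g"
        using fg basis[OF that] unfolding adjoint_in_def by blast
      hence "cnj (complex_of_real (t u) * cnj (ell2_fun f u)) = cnj (cnj (ell2_fun g u))"
        by (simp add: scaleR_scaleC cinner_scaleC_left)
      thus ?thesis by simp
    qed
    thus "(f, g) \<in> diag V t" using fg by (auto simp: adjoint_in_def intro: diagI)
  qed
  have "diag V t = adjoint_in (ell2_on V) (diag V t)" by (simp add: adjoint_diag)
  also have "\<dots> \<subseteq> adjoint_in (ell2_on V) A" using sub by (auto simp: adjoint_in_def)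
  finally show "diag V t \<subseteq> A" by (simp add: A)
qed

text \<open>\<open>A\<^sup>2 e = t\<^sup>2 e\<close> factors as \<open>(A + t) (A - t) e = 0\<close>, and \<open>A + t\<close> is injective for \<open>t > 0\<close>.\<close>

lemma positive_selfadjoint_eigenvector:
  assumes A: "positive_selfadjoint H A" and ek: "(e, k) \<in> A"
    and kt: "(k, complex_of_real (t\<^sup>2) *\<^sub>C e) \<in> A" and t: "0 \<le> t"
  shows "k = complex_of_real t *\<^sub>C e"
proof (cases "t = 0")
  case True
  have "(k, 0) \<in> adjoint_in H A"
    using A kt True by (simp add: positive_selfadjoint_def)
  hence "cinner k k = cinner e 0"
    using ek unfolding adjoint_in_def by blast
  thus ?thesis using True by (simp add: cinner_self_norm)
next
  case False
  have lin: "linear_operator H A" using A by (simp add: positive_selfadjoint_def)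
  define h where "h = k - complex_of_real t *\<^sub>C e"
  have "(h, complex_of_real (t\<^sup>2) *\<^sub>C e - complex_of_real t *\<^sub>C k) \<in> A"
    unfolding h_def by (intro linear_operator_diff[OF lin] kt linear_operatorD(2)[OF lin] ek)
  also have "complex_of_real (t\<^sup>2) *\<^sub>C e - complex_of_real t *\<^sub>C k = complex_of_real (- t) *\<^sub>C h"
    by (rule ell2_eqI) (simp add: h_def algebra_simps power2_eq_square)
  finally have "cinner (complex_of_real (- t) *\<^sub>C h) h \<in> \<real>\<^sub>\<ge>\<^sub>0"
    using A unfolding positive_selfadjoint_def by blast
  hence "0 \<le> - t * (norm h)\<^sup>2"
    unfolding cinner_scaleC_left cinner_self_norm of_real_mult[symmetric] nonneg_Reals_of_real_iff .
  hence "h = 0" using False t by (simp add: mult_le_0_iff)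
  thus ?thesis by (simp add: h_def)
qed

lemma modulus_eq_diag:
  assumes TT: "T O adjoint_in (ell2_on V) T = diag V t O diag V t"
    and t: "\<And>u. u \<in> V \<Longrightarrow> 0 \<le> t u"
  shows "modulus (ell2_on V) T = diag V t"
  unfolding modulus_def
proof (rule the_equality)
  show "positive_selfadjoint (ell2_on V) (diag V t) \<and> diag V t O diag V t = T O adjoint_in (ell2_on V) T"
    using positive_selfadjoint_diag[OF t] TT by simp
next
  fix A assume A: "positive_selfadjoint (ell2_on V) A \<and> A O A = T O adjoint_in (ell2_on V) T"
  show "A = diag V t"
  proof (rule selfadjoint_eq_diag)
    show "adjoint_in (ell2_on V) A = A" using A by (simp add: positive_selfadjoint_def)
    fix u assume u: "u \<in> V"
    have "(complex_of_real (t u) *\<^sub>C basis_vec u, complex_of_real (t u) *\<^sub>C complex_of_real (t u) *\<^sub>C basis_vec u) \<in> diag V t"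
      using linear_operatorD(2)[OF linear_operator_diag basis_vec_in_diag[OF u]]
      unfolding scaleR_scaleC .
    hence "(basis_vec u, complex_of_real (t u) *\<^sub>C complex_of_real (t u) *\<^sub>C basis_vec u) \<in> diag V t O diag V t"
      using basis_vec_in_diag[OF u, of t] unfolding scaleR_scaleC by blast
    hence "(basis_vec u, complex_of_real ((t u)\<^sup>2) *\<^sub>C basis_vec u) \<in> A O A"
      using A TT by (simp add: power2_eq_square)
    \<comment> \<open>The intermediate vector of the product is A e_u; it is not yet known to be a
      multiple of e_u.\<close>
    then obtain k where k: "(basis_vec u, k) \<in> A"
      "(k, complex_of_real ((t u)\<^sup>2) *\<^sub>C basis_vec u) \<in> A"
      by blast
    have "k = complex_of_real (t u) *\<^sub>C basis_vec u"
      by (rule positive_selfadjoint_eigenvector[OF conjunct1[OF A] k t[OF u]])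
    thus "(basis_vec u, t u *\<^sub>R basis_vec u) \<in> A" using k(1) by (simp add: scaleR_scaleC)
  qed
qed

lemma diagonal_operator_diag:
  assumes "\<And>u. u \<in> V \<Longrightarrow> 0 \<le> t u"
  shows "diagonal_operator (ell2_on V) V basis_vec t (diag V t)"
  unfolding diagonal_operator_def
  by (intro conjI ballI orthonormal_basis_basis_vec positive_selfadjoint_diag basis_vec_in_diag assms)

lemma closure_Range_diag: "closure (Range (diag V t)) = ell2_on {u \<in> V. t u \<noteq> 0}"
proof (rule closure_subspace_eq_ell2_on)
  show "cvec.subspace (Range (diag V t))" by (rule subspace_Range[OF linear_operator_diag])
  show "Range (diag V t) \<subseteq> ell2_on {u \<in> V. t u \<noteq> 0}"
  proof (intro subsetI)
    fix g assume "g \<in> Range (diag V t)"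
    then obtain f where g: "g \<in> ell2_on V" "\<forall>u\<in>V. ell2_fun g u = complex_of_real (t u) * ell2_fun f u"
      by (auto simp: diag_def)
    have "ell2_fun g u = 0" if "u \<notin> {u \<in> V. t u \<noteq> 0}" for u
      using g that by (cases "u \<in> V") (auto simp: ell2_on_def)
    thus "g \<in> ell2_on {u \<in> V. t u \<noteq> 0}" by (simp add: ell2_on_def)
  qed
  fix u assume "u \<in> {u \<in> V. t u \<noteq> 0}"
  hence "((1 / complex_of_real (t u)) *\<^sub>C basis_vec u, basis_vec u) \<in> diag V t"
    by (auto simp: diag_def ell2_on_def)
  thus "basis_vec u \<in> Range (diag V t)" by blast
qed

lemma op_kernel_diag: "op_kernel (diag V t) = ell2_on {u \<in> V. t u = 0}"
  by (auto simp: op_kernel_def diag_def ell2_on_def)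

section \<open>Bounded operators and uniqueness of the polar factor\<close>

text \<open>Composing with \<open>restr V\<close> turns the graph into a function that is total on
  the type, so that facts about \<open>bounded_linear\<close> apply to it.\<close>

lemma bounded_operator_extend:
  assumes lin: "linear_operator (ell2_on V) U" and dom: "Domain U = ell2_on V"
    and bdd: "\<forall>(f, f')\<in>U. norm f' \<le> c * norm f"
  obtains T where "bounded_linear T" "\<And>a f. T (a *\<^sub>C f) = a *\<^sub>C T f"
    "U = {(f, T f) | f. f \<in> ell2_on V}"
proof
  let ?T = "\<lambda>f. U \<cdot> restr V f"
  have restr: "restr V f \<in> ell2_on V" for f :: "'a ell2" by (simp add: ell2_on_def)
  have T: "(restr V f, ?T f) \<in> U" for f
  proof -
    obtain g where "(restr V f, g) \<in> U" using dom restr by blast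
    thus ?thesis using app_eqI[OF lin] by metis
  qed
  have eqI: "(restr V f, g) \<in> U \<Longrightarrow> ?T f = g" for f g by (rule app_eqI[OF lin])
  show scale: "?T (a *\<^sub>C f) = a *\<^sub>C ?T f" for a f
  proof (rule eqI)
    have "restr V (a *\<^sub>C f) = a *\<^sub>C restr V f" by (auto intro: ell2_eqI)
    thus "(restr V (a *\<^sub>C f), a *\<^sub>C ?T f) \<in> U" using linear_operatorD(2)[OF lin T] by simp
  qed
  \<comment> \<open>The bound c comes without a sign, hence the absolute value.\<close>
  show "bounded_linear ?T"
  proof (rule bounded_linear_intro[where K = "\<bar>c\<bar>"])
    fix f g :: "'a ell2"
    have "restr V (f + g) = restr V f + restr V g" by (auto intro: ell2_eqI)
    hence "(restr V (f + g), ?T f + ?T g) \<in> U" using linear_operatorD(1)[OF lin T T] by simp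
    thus "?T (f + g) = ?T f + ?T g" by (rule eqI)
    have "norm (?T f) \<le> c * norm (restr V f)" using bdd T by blast
    also have "\<dots> \<le> \<bar>c\<bar> * norm f"
      by (rule mult_mono) (auto simp: norm_restr_le)
    finally show "norm (?T f) \<le> norm f * \<bar>c\<bar>" by (simp add: mult.commute)
  qed (simp add: scaleR_scaleC scale)
  show "U = {(f, ?T f) | f. f \<in> ell2_on V}"
  proof (intro equalityI subrelI)
    fix f g assume fg: "(f, g) \<in> U"
    hence "f \<in> ell2_on V" by (rule linear_operatorD(5)[OF lin])
    moreover from this have "?T f = g" using fg by (intro eqI) (simp add: restr_eq_self)
    ultimately show "(f, g) \<in> {(f, ?T f) | f. f \<in> ell2_on V}" by blast
  next
    fix f g assume "(f, g) \<in> {(f, ?T f) | f. f \<in> ell2_on V}"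
    thus "(f, g) \<in> U" using T[of f] by (auto simp: restr_eq_self)
  qed
qed

lemma has_sum_bounded_operator:
  assumes "bounded_linear T" "\<And>a f. T (a *\<^sub>C f) = a *\<^sub>C T f" "f \<in> ell2_on V"
  shows "((\<lambda>u. ell2_fun f u *\<^sub>C T (basis_vec u)) has_sum T f) V"
  using has_sum_bounded_linear[OF assms(1) has_sum_basis_vec[OF assms(3)]]
  by (simp add: o_def assms(2))

text \<open>This is the Riesz representation of the coordinate functional at v, with an explicit
  vector: its coordinate at u is the conjugate of the v-th coordinate of
  \<open>T (basis_vec u)\<close>. Once this is known to be square summable, both sides are the same
  series over V.\<close>

lemma bounded_operator_coordinate:
  assumes T: "bounded_linear T" and scale: "\<And>a f. T (a *\<^sub>C f) = a *\<^sub>C T f"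
  obtains k where "k \<in> ell2_on V" "\<And>f. f \<in> ell2_on V \<Longrightarrow> ell2_fun (T f) v = cinner f k"
proof -
  define \<kappa> where "\<kappa> u = (if u \<in> V then cnj (ell2_fun (T (basis_vec u)) v) else 0)" for u
  obtain c where c: "norm (T f) \<le> norm f * c" "0 \<le> c" for f
    using bounded_linear.nonneg_bounded[OF T] by blast
  have "(\<Sum>u\<in>F. (cmod (\<kappa> u))\<^sup>2) \<le> c\<^sup>2" if F: "finite F" for F
  proof -
    define s where "s = (\<Sum>u\<in>F. (cmod (\<kappa> u))\<^sup>2)"
    \<comment> \<open>The test vector is \<kappa> cut off to F. The v-th coordinate of T f is then
      the squared norm of f, and it is at most c times the norm of f, so the norm of f is at most
      c.\<close>
    define f where "f = (\<Sum>u\<in>F. \<kappa> u *\<^sub>C basis_vec u)"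
    have f: "ell2_fun f u = (if u \<in> F then \<kappa> u else 0)" for u
      using F by (simp add: f_def if_distrib[of "(*) _"] sum.delta cong: if_cong)
    have "((\<lambda>u. (cmod (ell2_fun f u))\<^sup>2) has_sum s) F"
      by (rule has_sum_finiteI[OF F]) (simp add: s_def f)
    hence "((\<lambda>u. (cmod (ell2_fun f u))\<^sup>2) has_sum s) UNIV"
      by (rule has_sum_cong_neutral[THEN iffD1, rotated -1]) (auto simp: f)
    hence s: "(norm f)\<^sup>2 = s"
      using has_sum_unique has_sum_norm_power2 by blast
    have "T f = (\<Sum>u\<in>F. \<kappa> u *\<^sub>C T (basis_vec u))"
      unfolding f_def linear_sum[OF bounded_linear.linear[OF T]] scale ..
    hence "ell2_fun (T f) v = (\<Sum>u\<in>F. \<kappa> u * cnj (\<kappa> u))"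
      by (auto simp: \<kappa>_def intro!: sum.cong)
    also have "\<dots> = complex_of_real s"
      unfolding complex_norm_square[symmetric] by (simp add: s_def)
    finally have "s \<le> norm f * c"
      using cmod_ell2_fun_le_norm[of "T f" v] c(1)[of f] by simp
    hence "norm f * norm f \<le> norm f * c" unfolding s[symmetric] power2_eq_square .
    hence "norm f \<le> c" using c(2) by (cases "norm f = 0") (auto dest: mult_left_le_imp_le)
    hence "(norm f)\<^sup>2 \<le> c\<^sup>2" by (intro power_mono) auto
    thus ?thesis by (simp add: s s_def)
  qed
  hence "(\<lambda>u. (cmod (\<kappa> u))\<^sup>2) summable_on UNIV"
    by (intro nonneg_bdd_above_summable_on) (auto simp: bdd_above_def)
  hence k: "ell2_fun (Abs_ell2 \<kappa>) = \<kappa>" by (simp add: Abs_ell2_inverse)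
  show ?thesis
  proof
    show "Abs_ell2 \<kappa> \<in> ell2_on V" by (simp add: ell2_on_def k \<kappa>_def)
    fix f assume f: "f \<in> ell2_on V"
    have "((\<lambda>u. ell2_fun (ell2_fun f u *\<^sub>C T (basis_vec u)) v) has_sum ell2_fun (T f) v) V"
      using has_sum_bounded_linear[OF bounded_linear_ell2_fun has_sum_bounded_operator[OF T scale f]]
      by (simp add: o_def)
    moreover have "((\<lambda>u. ell2_fun f u * cnj (ell2_fun (Abs_ell2 \<kappa>) u)) has_sum cinner f (Abs_ell2 \<kappa>)) V"
      using has_sum_cinner_restr[of f "Abs_ell2 \<kappa>" V] f by (simp add: restr_eq_self)
    hence "((\<lambda>u. ell2_fun (ell2_fun f u *\<^sub>C T (basis_vec u)) v) has_sum cinner f (Abs_ell2 \<kappa>)) V"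
      by (rule has_sum_cong[THEN iffD1, rotated]) (simp add: k \<kappa>_def)
    ultimately show "ell2_fun (T f) v = cinner f (Abs_ell2 \<kappa>)" by (rule has_sum_unique)
  qed
qed

text \<open>The hypothesis describes only the complement of the kernel, so the last claim is checked
  at each coordinate v: the vector representing that coordinate lies in the initial space, hence in
  \<open>ell2_on W\<close>, and vanishes at w.\<close>

lemma partial_isometry_rep:
  assumes U: "partial_isometry (ell2_on V) U" and init: "initial_space (ell2_on V) U = ell2_on W"
  obtains T where "bounded_linear T" "\<And>a f. T (a *\<^sub>C f) = a *\<^sub>C T f"
    "U = {(f, T f) | f. f \<in> ell2_on V}" "\<And>w. w \<in> V - W \<Longrightarrow> T (basis_vec w) = 0"
proof -
  obtain c where c: "\<forall>(f, f')\<in>U. norm f' \<le> c * norm f"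
    using U unfolding partial_isometry_def by blast
  have lin: "linear_operator (ell2_on V) U" and dom: "Domain U = ell2_on V"
    using U by (simp_all add: partial_isometry_def)
  obtain T where T: "bounded_linear T" "\<And>a f. T (a *\<^sub>C f) = a *\<^sub>C T f"
    "U = {(f, T f) | f. f \<in> ell2_on V}"
    by (rule bounded_operator_extend[OF lin dom c]) (rule that)
  have "T (basis_vec w) = 0" if w: "w \<in> V - W" for w
  proof (rule ell2_eqI)
    fix v
    obtain k where k: "k \<in> ell2_on V" "\<And>f. f \<in> ell2_on V \<Longrightarrow> ell2_fun (T f) v = cinner f k"
      by (rule bounded_operator_coordinate[OF T(1,2), of V v]) (rule that)
    have "cinner k f = 0" if "f \<in> op_kernel U" for f
    proof -
      have "f \<in> ell2_on V" "T f = 0" using that T(3) by (auto simp: op_kernel_def)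
      hence "cinner f k = 0" using k(2)[of f] by simp
      thus ?thesis by (subst cinner_cnj) simp
    qed
    hence "k \<in> initial_space (ell2_on V) U" using k(1) by (simp add: initial_space_def ortho_in_def)
    hence "ell2_fun k w = 0" using init w by (simp add: ell2_on_def)
    moreover have "basis_vec w \<in> ell2_on V" using w by (auto simp: ell2_on_def)
    ultimately show "ell2_fun (T (basis_vec w)) v = ell2_fun 0 v" using k(2) by simp
  qed
  thus ?thesis by (rule that[OF T])
qed

text \<open>Where \<open>t u\<close> \<noteq> 0, the common product determines both partial
  isometries at \<open>t u\<close> times e_u; elsewhere both vanish because of the initial space.
  Boundedness extends the agreement from the basis to \<open>ell2_on V\<close>.\<close>

lemma polar_isometry_eq:
  assumes mod: "modulus (ell2_on V) T = diag V t"
    and U: "partial_isometry (ell2_on V) U" "initial_space (ell2_on V) U = ell2_on {u \<in> V. t u \<noteq> 0}"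
      "T = diag V t O U"
  shows "polar_isometry (ell2_on V) T = U"
  unfolding polar_isometry_def mod closure_Range_diag
proof (rule the_equality)
  let ?W = "{u \<in> V. t u \<noteq> 0}"
  fix U' assume U': "partial_isometry (ell2_on V) U' \<and> initial_space (ell2_on V) U' = ell2_on ?W \<and>
    T = diag V t O U'"
  obtain P where P: "bounded_linear P" "\<And>a f. P (a *\<^sub>C f) = a *\<^sub>C P f"
    "U = {(f, P f) | f. f \<in> ell2_on V}" "\<And>w. w \<in> V - ?W \<Longrightarrow> P (basis_vec w) = 0"
    by (rule partial_isometry_rep[OF U(1,2)]) (rule that)
  obtain Q where Q: "bounded_linear Q" "\<And>a f. Q (a *\<^sub>C f) = a *\<^sub>C Q f"
    "U' = {(f, Q f) | f. f \<in> ell2_on V}" "\<And>w. w \<in> V - ?W \<Longrightarrow> Q (basis_vec w) = 0"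
    by (rule partial_isometry_rep[OF conjunct1[OF U'] conjunct1[OF conjunct2[OF U']]]) (rule that)
  have PQ: "P (basis_vec u) = Q (basis_vec u)" if u: "u \<in> V" for u
  proof (cases "t u = 0")
    case False
    let ?e = "complex_of_real (t u) *\<^sub>C basis_vec u"
    have e: "(basis_vec u, ?e) \<in> diag V t"
      using basis_vec_in_diag[OF u] by (simp add: scaleR_scaleC)
    hence eV: "?e \<in> ell2_on V" by (simp add: diag_def)
    hence "(basis_vec u, P ?e) \<in> diag V t O U" using e P(3) by blast
    hence "(basis_vec u, P ?e) \<in> diag V t O U'" using U(3) U' by simp
    then obtain z where "(basis_vec u, z) \<in> diag V t" "(z, P ?e) \<in> U'" by blast
    hence "P ?e = Q ?e" using linear_operatorD(4)[OF linear_operator_diag _ e] Q(3) by blast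
    thus ?thesis using False P(2) Q(2) by simp
  qed (use u P(4) Q(4) in simp)
  have "P f = Q f" if "f \<in> ell2_on V" for f
  proof (rule has_sum_unique)
    show "((\<lambda>u. ell2_fun f u *\<^sub>C P (basis_vec u)) has_sum P f) V"
      by (rule has_sum_bounded_operator[OF P(1,2) that])
    show "((\<lambda>u. ell2_fun f u *\<^sub>C P (basis_vec u)) has_sum Q f) V"
      using has_sum_bounded_operator[OF Q(1,2) that]
      by (rule has_sum_cong[THEN iffD1, rotated]) (simp add: PQ)
  qed
  thus "U' = U" unfolding P(3) Q(3) by auto
qed (use U in simp)

lemma ell2_fun_Abs_ell2:
  assumes "(\<lambda>x. (cmod (f x))\<^sup>2) summable_on UNIV"
  shows "ell2_fun (Abs_ell2 f) = f"
  using assms by (simp add: Abs_ell2_inverse)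

section \<open>Directed trees: uniqueness of parents and of the root\<close>

lemma directed_treeD:
  assumes "directed_tree V E"
  shows "E \<subseteq> V \<times> V - {(v, v) | v. v \<in> V}"
    and "\<forall>u\<in>V. \<forall>v\<in>V. u \<noteq> v \<longrightarrow>
      (\<exists>p. length p \<ge> 2 \<and> set p \<subseteq> V \<and> hd p = u \<and> last p = v \<and>
           successively (\<lambda>x y. (x, y) \<in> E \<or> (y, x) \<in> E) p)"
    and "\<forall>v\<in>V. \<not> is_root V E v \<longrightarrow> (\<exists>!u. (u, v) \<in> E)"
  using assms unfolding directed_tree_def by - (elim conjE, assumption)+

lemma directed_tree_edges:
  assumes "directed_tree V E"
  shows "E \<subseteq> V \<times> V" and "(u, v) \<in> E \<Longrightarrow> (w, v) \<in> E \<Longrightarrow> u = w"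
proof -
  show E: "E \<subseteq> V \<times> V" using directed_treeD(1)[OF assms] by blast
  assume uv: "(u, v) \<in> E" and wv: "(w, v) \<in> E"
  hence "v \<in> V" "\<not> is_root V E v" using E by (auto simp: is_root_def)
  hence "\<exists>!u. (u, v) \<in> E" using directed_treeD(3)[OF assms] by blast
  thus "u = w" using uv wv by blast
qed

text \<open>Along an undirected path from a root every vertex is a descendant of the root.\<close>

lemma directed_tree_root_unique:
  assumes tree: "directed_tree V E" and r: "is_root V E r" and s: "is_root V E s"
  shows "r = s"
proof (rule ccontr)
  assume "r \<noteq> s"
  have "r \<in> V" "s \<in> V" using r s by (simp_all add: is_root_def)
  hence "\<exists>p. length p \<ge> 2 \<and> set p \<subseteq> V \<and> hd p = r \<and> last p = s \<and>
      successively (\<lambda>x y. (x, y) \<in> E \<or> (y, x) \<in> E) p"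
    using directed_treeD(2)[OF tree] \<open>r \<noteq> s\<close> by blast
  then obtain p where len: "length p \<ge> 2" and p: "hd p = r" "last p = s"
    "successively (\<lambda>x y. (x, y) \<in> E \<or> (y, x) \<in> E) p" by blast
  have "p \<noteq> []" using len by auto
  have "(r, hd p) \<in> E\<^sup>* \<Longrightarrow> (r, last p) \<in> E\<^sup>*"
    using \<open>p \<noteq> []\<close> p(3)
  proof (induction p)
    case (Cons x p)
    show ?case
    proof (cases p)
      case (Cons y q)
      have rx: "(r, x) \<in> E\<^sup>*" using Cons.prems by simp
      have "(x, y) \<in> E \<or> (y, x) \<in> E" using Cons.prems Cons by simp
      hence "(r, y) \<in> E\<^sup>*"
      proof
        assume yx: "(y, x) \<in> E"
        hence "x \<noteq> r" using r by (auto simp: is_root_def)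
        then obtain z where "(r, z) \<in> E\<^sup>*" "(z, x) \<in> E" using rtranclE[OF rx] by metis
        thus ?thesis using directed_tree_edges(2)[OF tree yx] by blast
      qed (use rx in simp)
      thus ?thesis using Cons.IH Cons.prems Cons by simp
    qed (use Cons.prems in simp)
  qed simp
  hence "(r, s) \<in> E\<^sup>*" using p(1,2) by simp
  thus False using \<open>r \<noteq> s\<close> s by (cases rule: rtranclE) (auto simp: is_root_def)
qed

section \<open>Decomposition of the non-roots into the sets of children\<close>

text \<open>Weights are kept out of this locale because their square summability on each set of
  children is itself derived in it, from density.\<close>

locale parent_graph =
  fixes V :: "'a set" and E :: "('a \<times> 'a) set"
  assumes edges: "E \<subseteq> V \<times> V"
    and parent_unique: "(u, v) \<in> E \<Longrightarrow> (u', v) \<in> E \<Longrightarrow> u = u'"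
begin

lemma nonroots_eq: "nonroots V E = (\<Union>u\<in>V. children E u)"
  using edges by (auto simp: nonroots_def is_root_def children_def)

lemma nonroots_eq': "nonroots V E = (\<Union>u\<in>nonleaves V E. children E u)"
  unfolding nonroots_eq nonleaves_def by blast

lemma nonroots_subset: "nonroots V E \<subseteq> V"
  by (auto simp: nonroots_def)

lemma parent_eq: "v \<in> children E u \<Longrightarrow> parent E v = u"
  using parent_unique unfolding parent_def children_def by blast

lemma children_nonroots: "u \<in> V \<Longrightarrow> v \<in> children E u \<Longrightarrow> v \<in> nonroots V E"
  unfolding nonroots_eq by blast

lemma disjoint_children: "disjoint_family_on (children E) I"
  using parent_unique by (auto simp: disjoint_family_on_def children_def)

lemma ell2_on_children_subset: "u \<in> V \<Longrightarrow> ell2_on (children E u) \<subseteq> ell2_on V"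
  using children_nonroots nonroots_subset by (fastforce simp: ell2_on_def)

text \<open>A non-root v occurs in exactly one pair (u, v), namely with its parent. Sums over the
  non-roots thereby become sums over vertices of sums over children.\<close>

lemma bij_snd_edges: "inj_on snd (SIGMA u:V. children E u)" "snd ` (SIGMA u:V. children E u) = nonroots V E"
proof -
  show "inj_on snd (SIGMA u:V. children E u)"
    using parent_unique by (auto simp: inj_on_def children_def)
  show "snd ` (SIGMA u:V. children E u) = nonroots V E"
    unfolding nonroots_eq by force
qed

lemma has_sum_children:
  fixes w :: "'a \<Rightarrow> 'b :: {topological_comm_monoid_add, t3_space}"
  assumes "(w has_sum s) (nonroots V E)" "\<And>u. u \<in> V \<Longrightarrow> (w has_sum g u) (children E u)"
  shows "(g has_sum s) V"
proof (rule has_sum_SigmaD)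
  show "((\<lambda>p. w (snd p)) has_sum s) (SIGMA u:V. children E u)"
    using assms(1) has_sum_reindex[OF bij_snd_edges(1), of w s] by (simp add: bij_snd_edges(2) o_def)
qed (use assms(2) in simp)

lemma summable_on_nonroots:
  fixes w :: "'a \<Rightarrow> real"
  assumes "g summable_on V" "\<And>u. u \<in> V \<Longrightarrow> (w has_sum g u) (children E u)"
    and "\<And>v. 0 \<le> w v"
  shows "w summable_on nonroots V E"
proof -
  have "(\<lambda>p. w (snd p)) summable_on (SIGMA u:V. children E u)"
    by (rule summable_on_SigmaI[OF _ assms(1)]) (use assms in simp_all)
  thus ?thesis
    using summable_on_reindex[OF bij_snd_edges(1), of w] by (simp add: bij_snd_edges(2) o_def)
qed

text \<open>Density puts some f of the domain within distance 1 of e_u, so f(u) \<noteq> 0. On the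
  children of u the image of f is f(u) times the weights, and dividing by f(u) gives the
  claim.\<close>

lemma square_summable_weights:
  assumes dense: "densely_defined (ell2_on V) (weighted_shift V E lam)" and u: "u \<in> V"
  shows "(\<lambda>v. (cmod (lam v))\<^sup>2) summable_on children E u"
proof -
  have "basis_vec u \<in> closure (Domain (weighted_shift V E lam))"
    using dense u by (auto simp: densely_defined_def ell2_on_def)
  then obtain f g where fg: "(f, g) \<in> weighted_shift V E lam" and "dist f (basis_vec u) < 1"
    using closure_approachable[of "basis_vec u"] zero_less_one by blast
  hence "cmod (ell2_fun (f - basis_vec u) u) < 1"
    using cmod_ell2_fun_le_norm by (metis dist_norm le_less_trans)
  hence f: "ell2_fun f u \<noteq> 0" by auto
  have "(\<lambda>v. (cmod (1 / ell2_fun f u * ell2_fun g v))\<^sup>2) summable_on children E u"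
    by (intro square_summable_scale summable_on_subset_banach[OF ell2_summable]) simp
  thus ?thesis
    by (rule summable_on_cong[THEN iffD1, rotated])
      (use fg f u parent_eq children_nonroots in \<open>simp add: weighted_shift_def shift_fun_def\<close>)
qed

end

section \<open>Weighted shifts: norm, domain, adjoint and modulus\<close>

text \<open>Square summability stands in for density because it passes at once from lambda to the
  normalised weights; the locale is used for both.\<close>

locale weighted_tree = parent_graph V E for V :: "'a set" and E :: "('a \<times> 'a) set" +
  fixes lam :: "'a \<Rightarrow> complex"
  assumes square_summable: "u \<in> V \<Longrightarrow> (\<lambda>v. (cmod (lam v))\<^sup>2) summable_on children E u"
begin

abbreviation S :: "'a oper" where "S \<equiv> weighted_shift V E lam"
abbreviation W :: "'a \<Rightarrow> 'a ell2" where "W \<equiv> weight_vec E lam"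

lemma ell2_fun_W:
  assumes "u \<in> V"
  shows "ell2_fun (W u) v = (if v \<in> children E u then lam v else 0)"
  unfolding weight_vec_def
  by (subst ell2_fun_Abs_ell2) (simp_all add: square_summable_restrict square_summable assms)

lemma W_in_ell2_on: "u \<in> V \<Longrightarrow> W u \<in> ell2_on (children E u)"
  by (simp add: ell2_on_def ell2_fun_W)

text \<open>Edges replace the description \<open>parent\<close>, and the value zero at a root is
  absorbed into the support of g.\<close>

lemma shift_iff:
  "(f, g) \<in> S \<longleftrightarrow> f \<in> ell2_on V \<and> g \<in> ell2_on (nonroots V E) \<and>
    (\<forall>u\<in>V. \<forall>v\<in>children E u. ell2_fun g v = lam v * ell2_fun f u)"
proof -
  have "ell2_fun g = shift_fun V E lam (ell2_fun f) \<longleftrightarrow> g \<in> ell2_on (nonroots V E) \<and>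
    (\<forall>u\<in>V. \<forall>v\<in>children E u. ell2_fun g v = lam v * ell2_fun f u)" (is "?l \<longleftrightarrow> ?r")
  proof
    assume ?l
    thus ?r using parent_eq children_nonroots by (auto simp: shift_fun_def ell2_on_def)
  next
    assume r: ?r
    show ?l
    proof (rule ext)
      fix v show "ell2_fun g v = shift_fun V E lam (ell2_fun f) v"
        using r parent_eq by (cases "v \<in> nonroots V E") (auto simp: shift_fun_def ell2_on_def nonroots_eq)
    qed
  qed
  moreover have "ell2_on (nonroots V E) \<subseteq> ell2_on V"
    using nonroots_subset by (auto simp: ell2_on_def)
  ultimately show ?thesis by (auto simp: weighted_shift_def)
qed

lemma linear_operator_shift: "linear_operator (ell2_on V) S"
proof -
  have "S \<subseteq> ell2_on V \<times> ell2_on V" by (auto simp: weighted_shift_def)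
  moreover have "single_valued S"
    by (auto simp: single_valued_def weighted_shift_def intro: ell2_fun_inject[THEN iffD1])
  ultimately show ?thesis
    unfolding linear_operator_def by (auto simp: shift_iff ell2_on_def algebra_simps)
qed

lemma shift_basis_vec: "u \<in> V \<Longrightarrow> (basis_vec u, W u) \<in> S"
  using W_in_ell2_on children_nonroots parent_unique
  by (fastforce simp: shift_iff ell2_fun_W ell2_on_def children_def)

lemma app_shift_basis_vec: "u \<in> V \<Longrightarrow> S \<cdot> basis_vec u = W u"
  by (rule app_eqI[OF linear_operator_shift shift_basis_vec])

lemma restr_shift:
  assumes "(f, g) \<in> S" "u \<in> V"
  shows "restr (children E u) g = ell2_fun f u *\<^sub>C W u"
  using assms by (intro ell2_eqI) (auto simp: shift_iff ell2_fun_W)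

text \<open>This is Pythagoras over the sets of children, on each of which g is f(u) times
  \<open>W u\<close>.\<close>

lemma shift_norm:
  assumes "(f, g) \<in> S"
  shows "((\<lambda>u. (norm (W u) * cmod (ell2_fun f u))\<^sup>2) has_sum (norm g)\<^sup>2) V"
proof (rule has_sum_children)
  have g: "g \<in> ell2_on (nonroots V E)" using assms by (simp add: shift_iff)
  show "((\<lambda>v. (cmod (ell2_fun g v))\<^sup>2) has_sum (norm g)\<^sup>2) (nonroots V E)"
    using has_sum_norm_restr_power2[of g "nonroots V E"] by (simp add: restr_eq_self g)
  fix u assume "u \<in> V"
  thus "((\<lambda>v. (cmod (ell2_fun g v))\<^sup>2) has_sum (norm (W u) * cmod (ell2_fun f u))\<^sup>2) (children E u)"
    using has_sum_norm_restr_power2[of g "children E u"] restr_shift[OF assms]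
    by (simp add: norm_scaleC mult.commute)
qed

text \<open>The norm identity is read backwards: the squared norms of the formal image h over the
  sets of children form the given summable family.\<close>

lemma shift_DomainI:
  assumes f: "f \<in> ell2_on V"
    and summ: "(\<lambda>u. (norm (W u) * cmod (ell2_fun f u))\<^sup>2) summable_on V"
  obtains g where "(f, g) \<in> S"
proof -
  define h where "h = shift_fun V E lam (ell2_fun f)"
  have h: "h v = lam v * ell2_fun f u" if "u \<in> V" "v \<in> children E u" for u v
    using that children_nonroots parent_eq by (simp add: h_def shift_fun_def)
  have "(\<lambda>v. (cmod (h v))\<^sup>2) summable_on nonroots V E"
  proof (rule summable_on_nonroots[OF summ])
    fix u assume u: "u \<in> V"
    have "((\<lambda>v. (cmod (ell2_fun (ell2_fun f u *\<^sub>C W u) v))\<^sup>2) has_sum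
        (norm (ell2_fun f u *\<^sub>C W u))\<^sup>2) (children E u)"
      using has_sum_norm_restr_power2[of "ell2_fun f u *\<^sub>C W u" "children E u"] W_in_ell2_on[OF u]
      by (simp add: restr_eq_self cvec.subspace_scale[OF subspace_ell2_on] del: scaleC.rep_eq)
    thus "((\<lambda>v. (cmod (h v))\<^sup>2) has_sum (norm (W u) * cmod (ell2_fun f u))\<^sup>2) (children E u)"
      unfolding norm_scaleC
      by (rule has_sum_cong[THEN iffD1, rotated, THEN back_subst[of "\<lambda>s. (_ has_sum s) _"]])
        (simp_all add: u h[OF u] ell2_fun_W mult.commute)
  qed simp
  hence "(\<lambda>v. (cmod (if v \<in> nonroots V E then h v else 0))\<^sup>2) summable_on UNIV"
    by (simp add: square_summable_restrict)
  moreover have "(if v \<in> nonroots V E then h v else 0) = h v" for v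
    by (simp add: h_def shift_fun_def)
  ultimately have "(\<lambda>v. (cmod (h v))\<^sup>2) summable_on UNIV" by simp
  hence "ell2_fun (Abs_ell2 h) = h" by (rule ell2_fun_Abs_ell2)
  hence "(f, Abs_ell2 h) \<in> S"
    using f nonroots_subset by (auto simp: weighted_shift_def ell2_on_def h_def shift_fun_def)
  thus ?thesis by (rule that)
qed

lemma op_kernel_shift: "op_kernel S = ell2_on {u \<in> V. W u = 0}"
proof (intro equalityI subsetI)
  fix f assume "f \<in> op_kernel S"
  hence f: "(f, 0) \<in> S" by (simp add: op_kernel_def)
  have "ell2_fun f u = 0" if "u \<in> V" "W u \<noteq> 0" for u
  proof -
    have "ell2_fun f u *\<^sub>C W u = restr (children E u) 0" using restr_shift[OF f] that by simp
    also have "\<dots> = 0" by (rule ell2_eqI) simp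
    finally show ?thesis using that by simp
  qed
  thus "f \<in> ell2_on {u \<in> V. W u = 0}" using f by (auto simp: shift_iff ell2_on_def)
next
  fix f assume f: "f \<in> ell2_on {u \<in> V. W u = 0}"
  have "lam v * ell2_fun f u = 0" if "u \<in> V" "v \<in> children E u" for u v
  proof (cases "W u = 0")
    case True
    hence "lam v = 0" using that ell2_fun_W[of u v] by simp
    thus ?thesis by simp
  qed (use f in \<open>simp add: ell2_on_def\<close>)
  thus "f \<in> op_kernel S" using f by (auto simp: op_kernel_def shift_iff ell2_on_def)
qed

text \<open>Basis vectors as test vectors give necessity; for sufficiency the inner product of the
  image of f with g is regrouped along the sets of children, each of which contributes f(u) times
  \<open>cinner (W u) g\<close>.\<close>

lemma adjoint_shift:
  "(g, h) \<in> adjoint_in (ell2_on V) S \<longleftrightarrow>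
    g \<in> ell2_on V \<and> h \<in> ell2_on V \<and> (\<forall>u\<in>V. ell2_fun h u = cinner g (W u))" (is "?l \<longleftrightarrow> ?r")
proof
  assume l: ?l
  have "ell2_fun h u = cinner g (W u)" if "u \<in> V" for u
  proof -
    have "cinner (W u) g = cinner (basis_vec u) h"
      using l shift_basis_vec[OF that] unfolding adjoint_in_def by blast
    hence "cnj (cinner g (W u)) = cnj (ell2_fun h u)"
      by (subst cinner_cnj[symmetric]) simp
    thus ?thesis by simp
  qed
  thus ?r using l by (auto simp: adjoint_in_def)
next
  assume r: ?r
  have "cinner f' g = cinner f h" if ff': "(f, f') \<in> S" for f f'
  proof (rule has_sum_unique)
    have f: "f \<in> ell2_on V" and f': "f' \<in> ell2_on (nonroots V E)" using ff' by (simp_all add: shift_iff)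
    show "((\<lambda>u. ell2_fun f u * cnj (ell2_fun h u)) has_sum cinner f h) V"
      using has_sum_cinner_restr[of f h V] f by (simp add: restr_eq_self)
    show "((\<lambda>u. ell2_fun f u * cnj (ell2_fun h u)) has_sum cinner f' g) V"
    proof (rule has_sum_children)
      show "((\<lambda>v. ell2_fun f' v * cnj (ell2_fun g v)) has_sum cinner f' g) (nonroots V E)"
        using has_sum_cinner_restr[of f' g "nonroots V E"] f' by (simp add: restr_eq_self)
      fix u assume u: "u \<in> V"
      have "cnj (ell2_fun h u) = cinner (W u) g" using r u cinner_cnj[of "W u" g] by simp
      thus "((\<lambda>v. ell2_fun f' v * cnj (ell2_fun g v)) has_sum
          ell2_fun f u * cnj (ell2_fun h u)) (children E u)"
        using has_sum_cinner_restr[of f' g "children E u"] restr_shift[OF ff' u]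
        by (simp add: cinner_scaleC_left)
    qed
  qed
  thus ?l using r by (auto simp: adjoint_in_def)
qed

lemma cinner_restr_W:
  assumes "u \<in> V"
  shows "cinner (restr (children E u) g) (W u) = cinner g (W u)"
proof -
  have eq: "ell2_fun (restr (children E u) g) v * cnj (ell2_fun (W u) v) =
      ell2_fun g v * cnj (ell2_fun (W u) v)" for v
    by (simp add: ell2_fun_W assms)
  show ?thesis unfolding cinner_def eq ..
qed

lemma cinner_shift_W:
  assumes "(f, g) \<in> S" "u \<in> V"
  shows "cinner g (W u) = complex_of_real ((norm (W u))\<^sup>2) * ell2_fun f u"
  using cinner_restr_W[OF assms(2), of g]
  by (simp add: restr_shift[OF assms] cinner_scaleC_left cinner_self_norm mult.commute)

lemma Domain_shift_eq_Domain_diag: "Domain S = Domain (diag V (\<lambda>u. norm (W u)))"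
proof (intro equalityI subsetI)
  fix f assume "f \<in> Domain S"
  then obtain g where fg: "(f, g) \<in> S" by blast
  hence f: "f \<in> ell2_on V" by (simp add: shift_iff)
  define h where "h u = complex_of_real (norm (W u)) * ell2_fun f u" for u
  have "(\<lambda>u. (cmod (h u))\<^sup>2) summable_on V"
    using has_sum_imp_summable[OF shift_norm[OF fg]] by (simp add: h_def norm_mult)
  hence "(\<lambda>u. (cmod (if u \<in> V then h u else 0))\<^sup>2) summable_on UNIV"
    by (simp add: square_summable_restrict)
  hence "ell2_fun (Abs_ell2 (\<lambda>u. if u \<in> V then h u else 0)) = (\<lambda>u. if u \<in> V then h u else 0)"
    by (rule ell2_fun_Abs_ell2)
  hence "(f, Abs_ell2 (\<lambda>u. if u \<in> V then h u else 0)) \<in> diag V (\<lambda>u. norm (W u))"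
    using f by (auto simp: diag_def ell2_on_def h_def)
  thus "f \<in> Domain (diag V (\<lambda>u. norm (W u)))" by blast
next
  fix f assume "f \<in> Domain (diag V (\<lambda>u. norm (W u)))"
  then obtain g where fg: "(f, g) \<in> diag V (\<lambda>u. norm (W u))" by blast
  have "(\<lambda>u. (cmod (ell2_fun g u))\<^sup>2) summable_on V"
    by (rule summable_on_subset_banach[OF ell2_summable]) simp
  hence "(\<lambda>u. (norm (W u) * cmod (ell2_fun f u))\<^sup>2) summable_on V"
    by (rule summable_on_cong[THEN iffD1, rotated]) (use fg in \<open>simp add: diag_def norm_mult\<close>)
  moreover have "f \<in> ell2_on V" using fg by (simp add: diag_def)
  ultimately show "f \<in> Domain S" by (metis shift_DomainI DomainI)
qed

text \<open>As both first factors have the same domain, only the second ones need comparing. The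
  adjoint yields \<open>cinner g (W u)\<close> at u, which is the squared norm of \<open>W u\<close>
  times f(u), the result of applying the diagonal operator twice.\<close>

lemma shift_adjoint_shift:
  "S O adjoint_in (ell2_on V) S = diag V (\<lambda>u. norm (W u)) O diag V (\<lambda>u. norm (W u))"
proof (intro equalityI subrelI)
  fix f h assume "(f, h) \<in> S O adjoint_in (ell2_on V) S"
  then obtain g where fg: "(f, g) \<in> S" and gh: "(g, h) \<in> adjoint_in (ell2_on V) S" by blast
  obtain k where fk: "(f, k) \<in> diag V (\<lambda>u. norm (W u))"
    using fg Domain_shift_eq_Domain_diag by blast
  have "(k, h) \<in> diag V (\<lambda>u. norm (W u))"
    using fk gh by (intro diagI)
      (auto simp: diag_def adjoint_shift cinner_shift_W[OF fg] power2_eq_square)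
  thus "(f, h) \<in> diag V (\<lambda>u. norm (W u)) O diag V (\<lambda>u. norm (W u))" using fk by blast
next
  fix f h assume "(f, h) \<in> diag V (\<lambda>u. norm (W u)) O diag V (\<lambda>u. norm (W u))"
  then obtain k where fk: "(f, k) \<in> diag V (\<lambda>u. norm (W u))"
    and kh: "(k, h) \<in> diag V (\<lambda>u. norm (W u))" by blast
  obtain g where fg: "(f, g) \<in> S" using fk Domain_shift_eq_Domain_diag by blast
  hence "g \<in> ell2_on V" using linear_operatorD(6)[OF linear_operator_shift] by blast
  hence "(g, h) \<in> adjoint_in (ell2_on V) S"
    using fk kh by (auto simp: diag_def adjoint_shift cinner_shift_W[OF fg] power2_eq_square)
  thus "(f, h) \<in> S O adjoint_in (ell2_on V) S" using fg by blast
qed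

lemma modulus_shift: "modulus (ell2_on V) S = diag V (\<lambda>u. norm (W u))"
  by (rule modulus_eq_diag[OF shift_adjoint_shift]) simp

lemma closure_Range_adjoint_shift:
  "closure (Range (adjoint_in (ell2_on V) S)) = ell2_on {u \<in> V. W u \<noteq> 0}"
proof (rule closure_subspace_eq_ell2_on)
  have "linear_operator (ell2_on V) (adjoint_in (ell2_on V) S)"
    unfolding linear_operator_def
  proof (intro conjI)
    show "single_valued (adjoint_in (ell2_on V) S)"
      by (auto simp: single_valued_def adjoint_shift intro!: ell2_on_eqI[of _ V])
  qed (auto simp: adjoint_shift cinner_add_left cinner_scaleC_left
      intro: cvec.subspace_add[OF subspace_ell2_on] cvec.subspace_scale[OF subspace_ell2_on]
        cvec.subspace_0[OF subspace_ell2_on])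
  thus "cvec.subspace (Range (adjoint_in (ell2_on V) S))" by (rule subspace_Range)
  show "Range (adjoint_in (ell2_on V) S) \<subseteq> ell2_on {u \<in> V. W u \<noteq> 0}"
  proof
    fix h assume "h \<in> Range (adjoint_in (ell2_on V) S)"
    then obtain g where "(g, h) \<in> adjoint_in (ell2_on V) S" by blast
    hence h: "h \<in> ell2_on V" "\<forall>u\<in>V. ell2_fun h u = cinner g (W u)"
      by (simp_all add: adjoint_shift)
    have "ell2_fun h u = 0" if "u \<notin> {u \<in> V. W u \<noteq> 0}" for u
      using h that by (cases "u \<in> V") (auto simp: ell2_on_def)
    thus "h \<in> ell2_on {u \<in> V. W u \<noteq> 0}" by (simp add: ell2_on_def)
  qed
next
  fix u assume u: "u \<in> {u \<in> V. W u \<noteq> 0}"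
  \<comment> \<open>The preimage of e_u is \<open>W u\<close> scaled so that its inner product with
    \<open>W u\<close> is 1. Orthogonality to the other \<open>W w\<close> is
    \<open>cinner_shift_W\<close> at the pair of e_u and its image \<open>W u\<close>.\<close>
  let ?g = "(1 / complex_of_real ((norm (W u))\<^sup>2)) *\<^sub>C W u"
  have "ell2_fun (basis_vec u) w = cinner ?g (W w)" if w: "w \<in> V" for w
  proof (cases "w = u")
    case False
    have "cinner (W u) (W w) = 0"
      using cinner_shift_W[OF shift_basis_vec w, of u] u False by simp
    thus ?thesis using False by (simp add: cinner_scaleC_left)
  qed (use u in \<open>simp add: cinner_scaleC_left cinner_self_norm\<close>)
  moreover have "?g \<in> ell2_on V"
    using u W_in_ell2_on ell2_on_children_subset by (blast intro: cvec.subspace_scale[OF subspace_ell2_on])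
  moreover have "basis_vec u \<in> ell2_on V" using u by (auto simp: ell2_on_def)
  ultimately have "(?g, basis_vec u) \<in> adjoint_in (ell2_on V) S" by (simp add: adjoint_shift)
  thus "basis_vec u \<in> Range (adjoint_in (ell2_on V) S)" by blast
qed

end

section \<open>Ranges, isometric shifts and the kernel of the adjoint\<close>

lemma ortho_in_ell2_on: "ell2_on V \<ominus> ell2_on K = ell2_on (V - K)"
proof (intro equalityI subsetI)
  fix f assume f: "f \<in> ell2_on V \<ominus> ell2_on K"
  have "ell2_fun f k = 0" if "k \<in> K" for k
  proof -
    have "basis_vec k \<in> ell2_on K" using that by (auto simp: ell2_on_def)
    hence "cinner f (basis_vec k) = 0" using f unfolding ortho_in_def by blast
    thus ?thesis by simp
  qed
  thus "f \<in> ell2_on (V - K)" using f by (auto simp: ortho_in_def ell2_on_def)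
next
  fix f assume f: "f \<in> ell2_on (V - K)"
  hence "cinner f g = 0" if "g \<in> ell2_on K" for g
    by (rule cinner_eq_0_disjoint[OF _ that]) blast
  thus "f \<in> ell2_on V \<ominus> ell2_on K" using f by (auto simp: ortho_in_def ell2_on_def)
qed

context weighted_tree
begin

lemma nonleaves_subset: "u \<in> nonleaves V E \<Longrightarrow> u \<in> V"
  by (simp add: nonleaves_def)

lemma W_leaf: "u \<in> V \<Longrightarrow> u \<notin> nonleaves V E \<Longrightarrow> W u = 0"
  by (rule ell2_eqI) (simp add: ell2_fun_W nonleaves_def)

lemma span_W_subset: "u \<in> nonleaves V E \<Longrightarrow> cvec.span {W u} \<subseteq> ell2_on (children E u)"
  by (rule cvec.span_minimal) (auto simp: subspace_ell2_on intro: W_in_ell2_on nonleaves_subset)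

lemmas hilbert_sum_span_W = hilbert_sum_disjoint[OF disjoint_children span_W_subset]

lemma Range_shift_subset: "Range S \<subseteq> hilbert_sum (nonleaves V E) (\<lambda>u. cvec.span {W u})"
proof
  fix g assume "g \<in> Range S"
  then obtain f where fg: "(f, g) \<in> S" by blast
  have "restr (children E u) g \<in> cvec.span {W u}" if "u \<in> nonleaves V E" for u
    using restr_shift[OF fg nonleaves_subset[OF that]]
    by (simp add: cvec.span_scale cvec.span_base)
  moreover have "g \<in> ell2_on (nonroots V E)" using fg by (simp add: shift_iff)
  ultimately show "g \<in> hilbert_sum (nonleaves V E) (\<lambda>u. cvec.span {W u})"
    by (simp add: hilbert_sum_span_W nonroots_eq')
qed

text \<open>The Hilbert sum is closed and contains the range. Conversely, its finite partial sums
  lie in the range, because \<open>W u\<close> is the image of e_u.\<close>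

lemma closure_Range_shift:
  "closure (Range S) = hilbert_sum (nonleaves V E) (\<lambda>u. cvec.span {W u})"
proof
  show "closure (Range S) \<subseteq> hilbert_sum (nonleaves V E) (\<lambda>u. cvec.span {W u})"
    by (intro closure_minimal Range_shift_subset closed_hilbert_sum_disjoint[OF disjoint_children]
        span_W_subset closed_span_singleton)
  show "hilbert_sum (nonleaves V E) (\<lambda>u. cvec.span {W u}) \<subseteq> closure (Range S)"
  proof
    fix f assume "f \<in> hilbert_sum (nonleaves V E) (\<lambda>u. cvec.span {W u})"
    then obtain g where g: "\<And>u. u \<in> nonleaves V E \<Longrightarrow> g u \<in> cvec.span {W u}"
      "(g has_sum f) (nonleaves V E)"
      by (auto simp: hilbert_sum_def)
    note sub = subspace_Range[OF linear_operator_shift]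
    show "f \<in> closure (Range S)"
    proof (rule has_sum_in_closure[OF g(2)])
      fix F assume F: "F \<subseteq> nonleaves V E"
      show "sum g F \<in> Range S"
      proof (rule cvec.subspace_sum[OF sub])
        fix u assume "u \<in> F"
        hence u: "u \<in> nonleaves V E" using F by blast
        hence "W u \<in> Range S" using shift_basis_vec nonleaves_subset by blast
        hence "cvec.span {W u} \<subseteq> Range S" by (intro cvec.span_minimal sub) simp
        thus "g u \<in> Range S" using g(1)[OF u] by blast
      qed
    qed
  qed
qed

text \<open>For general weights the coefficients of an element of the Hilbert sum need not be square
  summable. If every \<open>W u\<close> is zero or a unit vector, they can be chosen as large as the
  norms of the blocks, and so they form a preimage.\<close>

lemma Range_shift_eq:
  assumes iso: "\<And>u. u \<in> V \<Longrightarrow> W u = 0 \<or> norm (W u) = 1"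
  shows "Range S = hilbert_sum (nonleaves V E) (\<lambda>u. cvec.span {W u})"
proof
  show "hilbert_sum (nonleaves V E) (\<lambda>u. cvec.span {W u}) \<subseteq> Range S"
  proof
    fix f assume "f \<in> hilbert_sum (nonleaves V E) (\<lambda>u. cvec.span {W u})"
    hence f: "f \<in> ell2_on (nonroots V E)"
      "\<And>u. u \<in> nonleaves V E \<Longrightarrow> restr (children E u) f \<in> cvec.span {W u}"
      by (simp_all add: hilbert_sum_span_W nonroots_eq')
    have "\<exists>c. restr (children E u) f = c *\<^sub>C W u \<and> cmod c = norm (restr (children E u) f)"
      if u: "u \<in> V" for u
    proof -
      have "restr (children E u) f \<in> cvec.span {W u}"
      proof (cases "u \<in> nonleaves V E")
        case False
        hence "restr (children E u) f = 0" using u by (intro ell2_eqI) (simp add: nonleaves_def)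
        thus ?thesis by (simp add: cvec.span_zero)
      qed (rule f)
      then obtain c where c: "restr (children E u) f = c *\<^sub>C W u"
        by (auto simp: cvec.span_singleton)
      show ?thesis
      proof (cases "W u = 0")
        case True
        \<comment> \<open>The coefficient is arbitrary here; zero is the choice that matches the
          norm of the vanishing block.\<close>
        thus ?thesis using c by (intro exI[of _ 0]) simp
      next
        case False
        hence "norm (W u) = 1" using iso[OF u] by blast
        thus ?thesis using c by (intro exI[of _ c]) (simp add: norm_scaleC)
      qed
    qed
    then obtain c where c: "\<And>u. u \<in> V \<Longrightarrow> restr (children E u) f = c u *\<^sub>C W u"
      "\<And>u. u \<in> V \<Longrightarrow> cmod (c u) = norm (restr (children E u) f)"
      by metis
    have "((\<lambda>u. (norm (restr (children E u) f))\<^sup>2) has_sum (norm f)\<^sup>2) V"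
    proof (rule has_sum_children)
      show "((\<lambda>v. (cmod (ell2_fun f v))\<^sup>2) has_sum (norm f)\<^sup>2) (nonroots V E)"
        using has_sum_norm_restr_power2[of f "nonroots V E"] by (simp add: restr_eq_self f(1))
    qed (rule has_sum_norm_restr_power2)
    hence "(\<lambda>u. (norm (restr (children E u) f))\<^sup>2) summable_on V" by (rule has_sum_imp_summable)
    hence "(\<lambda>u. (cmod (c u))\<^sup>2) summable_on V"
      by (rule summable_on_cong[THEN iffD1, rotated]) (simp add: c(2))
    hence "(\<lambda>u. (cmod (if u \<in> V then c u else 0))\<^sup>2) summable_on UNIV"
      by (simp add: square_summable_restrict)
    hence h: "ell2_fun (Abs_ell2 (\<lambda>u. if u \<in> V then c u else 0)) = (\<lambda>u. if u \<in> V then c u else 0)"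
      by (rule ell2_fun_Abs_ell2)
    have "ell2_fun f v = lam v * c u" if "u \<in> V" "v \<in> children E u" for u v
    proof -
      have "ell2_fun f v = ell2_fun (restr (children E u) f) v" using that by simp
      also have "\<dots> = c u * lam v" using that by (simp add: c(1) ell2_fun_W)
      finally show ?thesis by (simp add: mult.commute)
    qed
    hence "(Abs_ell2 (\<lambda>u. if u \<in> V then c u else 0), f) \<in> S"
      using f(1) by (simp add: shift_iff ell2_on_def h)
    thus "f \<in> Range S" by blast
  qed
qed (rule Range_shift_subset)

lemma initial_space_shift: "initial_space (ell2_on V) S = ell2_on {u \<in> V. W u \<noteq> 0}"
proof -
  have "V - {u \<in> V. W u = 0} = {u \<in> V. W u \<noteq> 0}" by blast
  thus ?thesis by (simp add: initial_space_def op_kernel_shift ortho_in_ell2_on)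
qed

text \<open>Since each \<open>W u\<close> has norm 0 or 1, the norm identity says that g is as long
  as the restriction of f to the vertices with \<open>W u\<close> \<noteq> 0. This gives the bound
  and the isometry on the initial space at once.\<close>

lemma partial_isometry_shift:
  assumes iso: "\<And>u. u \<in> V \<Longrightarrow> W u = 0 \<or> norm (W u) = 1"
  shows "partial_isometry (ell2_on V) S"
proof -
  let ?P = "{u \<in> V. W u \<noteq> 0}"
  have norm: "norm g = norm (restr ?P f)" if "(f, g) \<in> S" for f g
  proof -
    have "((\<lambda>u. (cmod (ell2_fun f u))\<^sup>2) has_sum (norm g)\<^sup>2) ?P"
      using shift_norm[OF that]
      by (rule has_sum_cong_neutral[THEN iffD1, rotated -1]) (use iso in auto)
    hence "(norm g)\<^sup>2 = (norm (restr ?P f))\<^sup>2"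
      using has_sum_norm_restr_power2 has_sum_unique by blast
    thus ?thesis by (rule power2_eq_imp_eq) auto
  qed
  have "\<forall>(f, g)\<in>S. norm g \<le> 1 * norm f" using norm norm_restr_le by auto
  moreover have "\<forall>(f, g)\<in>S. f \<in> initial_space (ell2_on V) S \<longrightarrow> norm g = norm f"
    using norm by (auto simp: initial_space_shift restr_eq_self)
  moreover have "Domain S = ell2_on V"
  proof (intro equalityI subsetI)
    fix f assume f: "f \<in> ell2_on V"
    have "(\<lambda>u. (cmod (ell2_fun f u))\<^sup>2) summable_on V"
      by (rule summable_on_subset_banach[OF ell2_summable]) simp
    hence "(\<lambda>u. (norm (W u) * cmod (ell2_fun f u))\<^sup>2) summable_on V"
    proof (rule summable_on_comparison_test)
      fix u assume "u \<in> V"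
      thus "(norm (W u) * cmod (ell2_fun f u))\<^sup>2 \<le> (cmod (ell2_fun f u))\<^sup>2"
        using iso by fastforce
    qed simp
    then obtain g where "(f, g) \<in> S" by (rule shift_DomainI[OF f])
    thus "f \<in> Domain S" by blast
  qed (auto simp: shift_iff)
  ultimately show ?thesis
    unfolding partial_isometry_def using linear_operator_shift by blast
qed

lemma op_kernel_adjoint_shift:
  "op_kernel (adjoint_in (ell2_on V) S) = {g \<in> ell2_on V. \<forall>u\<in>V. cinner g (W u) = 0}"
  by (auto simp: op_kernel_def adjoint_shift cvec.subspace_0[OF subspace_ell2_on])

text \<open>Orthogonality to \<open>W u\<close> concerns only the block on the children of u. At a
  vertex without children \<open>W u\<close> = 0, so letting u range over all of V adds no condition
  and matches the kernel of the adjoint.\<close>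

lemma hilbert_sum_ortho_W:
  "hilbert_sum (nonleaves V E) (\<lambda>u. ell2_on (children E u) \<ominus> cvec.span {W u}) =
    {g \<in> ell2_on (nonroots V E). \<forall>u\<in>V. cinner g (W u) = 0}"
proof -
  have "restr (children E u) g \<in> ell2_on (children E u) \<ominus> cvec.span {W u} \<longleftrightarrow> cinner g (W u) = 0"
    if "u \<in> V" for u g
  proof -
    have "restr (children E u) g \<in> ell2_on (children E u)" by (simp add: ell2_on_def)
    moreover have "(\<forall>h\<in>cvec.span {W u}. cinner (restr (children E u) g) h = 0) \<longleftrightarrow> cinner g (W u) = 0"
      unfolding cvec.span_singleton
      by (auto simp: cinner_scaleC_right cinner_restr_W[OF that] dest: spec[of _ 1])
    ultimately show ?thesis by (simp add: ortho_in_def)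
  qed
  moreover have "cinner g (W u) = 0" if "u \<in> V" "u \<notin> nonleaves V E" for u g
    using W_leaf[OF that] by simp
  ultimately show ?thesis
    by (subst hilbert_sum_disjoint[OF disjoint_children])
      (auto simp: ortho_in_def nonroots_eq' nonleaves_subset)
qed

lemma orthogonal_family_children:
  assumes "\<And>u. u \<in> I \<Longrightarrow> M u \<subseteq> ell2_on (children E u)"
  shows "orthogonal_family I M"
  by (rule orthogonal_family_disjoint[OF disjoint_children assms])

text \<open>The root is nobody's child, so e_r is orthogonal to every \<open>W u\<close>. Removing
  the root component leaves a vector on the non-roots that satisfies the same equations.\<close>

lemma op_kernel_adjoint_shift_rooted:
  assumes r: "V - nonroots V E = {r}"
  shows "op_kernel (adjoint_in (ell2_on V) S) =
    cvec.span {basis_vec r} + {g \<in> ell2_on (nonroots V E). \<forall>u\<in>V. cinner g (W u) = 0}"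
    (is "_ = ?R + ?H")
proof (intro equalityI subsetI)
  have root: "cinner (basis_vec r) (W u) = 0" if "u \<in> V" for u
  proof -
    have "r \<notin> children E u" using r children_nonroots[OF that] by blast
    thus ?thesis by (simp add: ell2_fun_W that)
  qed
  {
    fix g assume g: "g \<in> op_kernel (adjoint_in (ell2_on V) S)"
    hence gV: "g \<in> ell2_on V" by (simp add: op_kernel_adjoint_shift)
    have "restr (nonroots V E) g = g - ell2_fun g r *\<^sub>C basis_vec r"
    proof (rule ell2_eqI)
      fix v
      consider "v = r" | "v \<in> nonroots V E" | "v \<notin> V" using r by blast
      thus "ell2_fun (restr (nonroots V E) g) v = ell2_fun (g - ell2_fun g r *\<^sub>C basis_vec r) v"
        by cases (use gV r nonroots_subset in \<open>auto simp: ell2_on_def\<close>)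
    qed
    hence eq: "g = ell2_fun g r *\<^sub>C basis_vec r + restr (nonroots V E) g" by simp
    have "cinner (restr (nonroots V E) g) (W u) = 0" if "u \<in> V" for u
    proof -
      have "cinner g (W u) = 0" using g that by (simp add: op_kernel_adjoint_shift)
      thus ?thesis using root[OF that]
        by (subst (asm) eq) (simp add: cinner_add_left cinner_scaleC_left del: cinner_basis_vec_left)
    qed
    hence "restr (nonroots V E) g \<in> ?H" by (simp add: ell2_on_def)
    moreover have "ell2_fun g r *\<^sub>C basis_vec r \<in> ?R" by (simp add: cvec.span_scale cvec.span_base)
    ultimately show "g \<in> ?R + ?H" by (subst eq) (rule set_plus_intro)
  }
  fix g assume "g \<in> ?R + ?H"
  then obtain c h where g: "g = c *\<^sub>C basis_vec r + h" and h: "h \<in> ?H"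
    by (auto simp: set_plus_def cvec.span_singleton)
  have "g \<in> ell2_on V" using g h r nonroots_subset by (auto simp: ell2_on_def)
  thus "g \<in> op_kernel (adjoint_in (ell2_on V) S)"
    using h root by (simp add: op_kernel_adjoint_shift g cinner_add_left cinner_scaleC_left
        del: cinner_basis_vec_left)
qed

section \<open>Normalised weights and the polar decomposition\<close>

definition polar_weight :: "'a \<Rightarrow> complex"
  where "polar_weight v = (if parent E v \<in> V \<and> W (parent E v) \<noteq> 0
    then lam v / complex_of_real (norm (W (parent E v))) else 0)"

text \<open>No case distinction remains: if \<open>W u\<close> = 0, then \<open>lam v\<close> = 0
  too, and both sides vanish.\<close>

lemma polar_weight_child:
  assumes "u \<in> V" "v \<in> children E u"
  shows "polar_weight v = (1 / complex_of_real (norm (W u))) * lam v"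
proof (cases "W u = 0")
  case True
  hence "lam v = 0" using ell2_fun_W[OF assms(1), of v] assms(2) by simp
  thus ?thesis by (simp add: polar_weight_def)
qed (use assms parent_eq in \<open>simp add: polar_weight_def\<close>)

lemma weighted_tree_polar_weight: "weighted_tree V E polar_weight"
proof
  fix u assume u: "u \<in> V"
  have "(\<lambda>v. (cmod ((1 / complex_of_real (norm (W u))) * lam v))\<^sup>2) summable_on children E u"
    by (rule square_summable_scale[OF square_summable[OF u]])
  thus "(\<lambda>v. (cmod (polar_weight v))\<^sup>2) summable_on children E u"
    by (rule summable_on_cong[THEN iffD1, rotated]) (simp add: polar_weight_child[OF u])
qed

lemma weight_vec_polar_weight:
  assumes "u \<in> V"
  shows "weight_vec E polar_weight u = (1 / complex_of_real (norm (W u))) *\<^sub>C W u"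
  using polar_weight_child[OF assms]
  by (intro ell2_eqI)
    (simp add: weighted_tree.ell2_fun_W[OF weighted_tree_polar_weight assms] ell2_fun_W[OF assms])

lemma weight_vec_polar_weight_eq_0: "u \<in> V \<Longrightarrow> weight_vec E polar_weight u = 0 \<longleftrightarrow> W u = 0"
  by (simp add: weight_vec_polar_weight)

lemma polar_weight_isometric:
  "u \<in> V \<Longrightarrow> weight_vec E polar_weight u = 0 \<or> norm (weight_vec E polar_weight u) = 1"
  by (simp add: weight_vec_polar_weight norm_scaleC norm_divide)

text \<open>Normalising changes no line, which lets the range of the polar factor be compared with
  the closed range of the original shift.\<close>

lemma span_polar_weight: "u \<in> V \<Longrightarrow> cvec.span {weight_vec E polar_weight u} = cvec.span {W u}"
proof (cases "W u = 0")
  case False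
  assume u: "u \<in> V"
  have "W u = complex_of_real (norm (W u)) *\<^sub>C weight_vec E polar_weight u"
    using False by (simp add: weight_vec_polar_weight[OF u])
  hence "W u \<in> cvec.span {weight_vec E polar_weight u}"
    by (metis cvec.span_base cvec.span_scale singletonI)
  moreover have "weight_vec E polar_weight u \<in> cvec.span {W u}"
    by (simp add: weight_vec_polar_weight[OF u] cvec.span_base cvec.span_scale)
  ultimately show ?thesis by (simp add: cvec.span_eq)
qed (simp add: weight_vec_polar_weight)

text \<open>If k is the diagonal image of f, then \<open>(k, g)\<close> and \<open>(f, g)\<close>
  satisfy the same equations on edges, since normalised weight times norm gives back
  \<open>lam v\<close>, also where the norm is zero. Equality of the domains supplies k.\<close>

lemma shift_eq_diag_polar: "S = diag V (\<lambda>u. norm (W u)) O weighted_shift V E polar_weight"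
proof -
  interpret P: weighted_tree V E polar_weight by (rule weighted_tree_polar_weight)
  have weight: "polar_weight v * complex_of_real (norm (W u)) = lam v"
    if "u \<in> V" "v \<in> children E u" for u v
  proof (cases "W u = 0")
    case True
    hence "lam v = 0" using ell2_fun_W[OF that(1), of v] that(2) by simp
    thus ?thesis using True by simp
  qed (simp add: polar_weight_child[OF that])
  have iff: "(k, g) \<in> weighted_shift V E polar_weight \<longleftrightarrow> (f, g) \<in> S"
    if "(f, k) \<in> diag V (\<lambda>u. norm (W u))" for f k g
    using that weight by (simp add: P.shift_iff shift_iff diag_def mult.assoc[symmetric])
  show ?thesis
  proof (intro equalityI subrelI)
    fix f g assume fg: "(f, g) \<in> S"
    then obtain k where "(f, k) \<in> diag V (\<lambda>u. norm (W u))"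
      using Domain_shift_eq_Domain_diag by blast
    thus "(f, g) \<in> diag V (\<lambda>u. norm (W u)) O weighted_shift V E polar_weight"
      using iff fg by blast
  qed (use iff in blast)
qed

lemma polar_isometry_shift: "polar_isometry (ell2_on V) S = weighted_shift V E polar_weight"
proof (rule polar_isometry_eq[OF modulus_shift])
  interpret P: weighted_tree V E polar_weight by (rule weighted_tree_polar_weight)
  show "partial_isometry (ell2_on V) P.S"
    by (rule P.partial_isometry_shift[OF polar_weight_isometric])
  show "initial_space (ell2_on V) P.S = ell2_on {u \<in> V. norm (W u) \<noteq> 0}"
    unfolding P.initial_space_shift using weight_vec_polar_weight_eq_0
    by (intro arg_cong[of _ _ ell2_on]) auto
qed (rule shift_eq_diag_polar)

lemma Range_polar_isometry: "Range (weighted_shift V E polar_weight) = closure (Range S)"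
proof -
  interpret P: weighted_tree V E polar_weight by (rule weighted_tree_polar_weight)
  have "Range P.S = hilbert_sum (nonleaves V E) (\<lambda>u. cvec.span {P.W u})"
    by (rule P.Range_shift_eq[OF polar_weight_isometric])
  also have "\<dots> = hilbert_sum (nonleaves V E) (\<lambda>u. cvec.span {W u})"
    unfolding hilbert_sum_def using span_polar_weight nonleaves_subset by simp
  finally show ?thesis by (simp add: closure_Range_shift)
qed

end

theorem proposition3p5p1:
  fixes V :: "'a set" and E :: "('a \<times> 'a) set" and lam :: "'a \<Rightarrow> complex"
  defines "H \<equiv> ell2_on V"
    and "S \<equiv> weighted_shift V E lam"
  defines "absS \<equiv> modulus H S"
    and "U \<equiv> polar_isometry H S"
    and "Vplus \<equiv> {u \<in> V. norm (S \<cdot> basis_vec u) > 0}"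
    and "V' \<equiv> nonleaves V E"
    and "C \<equiv> (\<lambda>u. ell2_on (children E u) \<ominus> cvec.span {weight_vec E lam u})"
    and "L \<equiv> (\<lambda>u. cvec.span {weight_vec E lam u})"
    and "R \<equiv> cvec.span {basis_vec (tree_root V E)}"
  defines "\<pi> \<equiv> (\<lambda>u. if parent E u \<in> Vplus
                     then lam u / complex_of_real (norm (S \<cdot> basis_vec (parent E u))) else 0)"
  assumes tree: "directed_tree V E"
    and dense: "densely_defined H S"
  shows "diagonal_operator H V basis_vec (\<lambda>u. norm (S \<cdot> basis_vec u)) absS \<and>
    U = weighted_shift V E \<pi> \<and>
    (op_kernel U = op_kernel S \<and> op_kernel S = op_kernel absS \<and> op_kernel absS = ell2_on (V - Vplus) \<and>
      closure (Range (adjoint_in H S)) = ell2_on Vplus) \<and>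
    (orthogonal_family V' C \<and>
      (if \<exists>r. is_root V E r
       then orthogonal_sets R (hilbert_sum V' C) \<and> op_kernel (adjoint_in H S) = R + hilbert_sum V' C
       else op_kernel (adjoint_in H S) = hilbert_sum V' C)) \<and>
    initial_space H U = ell2_on Vplus \<and>
    (Range U = closure (Range S) \<and>
      orthogonal_family V' L \<and> closure (Range S) = hilbert_sum V' L)"
proof -
  interpret parent_graph V E
    using directed_tree_edges[OF tree] by unfold_locales blast+
  interpret weighted_tree V E lam
    using square_summable_weights dense unfolding H_def S_def by unfold_locales
  interpret P: weighted_tree V E polar_weight by (rule weighted_tree_polar_weight)
  have Se: "S \<cdot> basis_vec u = weight_vec E lam u" if "u \<in> V" for u
    unfolding S_def by (rule app_shift_basis_vec[OF that])
  have Vp: "Vplus = {u \<in> V. weight_vec E lam u \<noteq> 0}"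
    using Se by (auto simp: Vplus_def)
  have VVp: "V - Vplus = {u \<in> V. weight_vec E lam u = 0}"
    unfolding Vp by blast
  \<comment> \<open>Both functions apply the same test to \<open>parent E u\<close>, so they agree
    even at a root, where the parent is an unspecified value.\<close>
  have pi: "\<pi> = polar_weight"
    unfolding \<pi>_def polar_weight_def Vp by (auto simp: Se fun_eq_iff)
  have absS: "absS = diag V (\<lambda>u. norm (weight_vec E lam u))"
    unfolding absS_def H_def S_def by (rule modulus_shift)
  have U: "U = weighted_shift V E polar_weight"
    unfolding U_def H_def S_def by (rule polar_isometry_shift)
  have Vpolar: "{u \<in> V. weight_vec E polar_weight u = 0} = V - Vplus"
    "{u \<in> V. weight_vec E polar_weight u \<noteq> 0} = Vplus"
    using weight_vec_polar_weight_eq_0 unfolding Vp by blast+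
  have diagonal: "diagonal_operator H V basis_vec (\<lambda>u. norm (S \<cdot> basis_vec u)) absS"
  proof -
    \<comment> \<open>Off V the value \<open>S \<cdot> basis_vec u\<close> is unspecified, but a
      diagonal operator reads its elements on V only.\<close>
    have "diag V (\<lambda>u. norm (weight_vec E lam u)) = diag V (\<lambda>u. norm (S \<cdot> basis_vec u))"
      by (auto simp: diag_def Se)
    thus ?thesis unfolding absS H_def by (simp add: diagonal_operator_diag)
  qed
  have kernels: "op_kernel U = ell2_on (V - Vplus)" "op_kernel S = ell2_on (V - Vplus)"
    "op_kernel absS = ell2_on (V - Vplus)"
    unfolding U absS P.op_kernel_shift Vpolar op_kernel_diag
    by (simp_all add: S_def op_kernel_shift VVp)
  have range_adjoint: "closure (Range (adjoint_in H S)) = ell2_on Vplus"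
    unfolding H_def S_def Vp by (rule closure_Range_adjoint_shift)
  have initial: "initial_space H U = ell2_on Vplus"
    unfolding U H_def P.initial_space_shift Vpolar ..
  have ranges: "Range U = closure (Range S)" "closure (Range S) = hilbert_sum V' L"
    unfolding U S_def V'_def L_def by (rule Range_polar_isometry closure_Range_shift)+
  have orthogonal: "orthogonal_family V' C" "orthogonal_family V' L"
    unfolding V'_def C_def L_def
    by (rule orthogonal_family_children; use span_W_subset in \<open>auto simp: ortho_in_def\<close>)+
  have HC: "hilbert_sum V' C = {g \<in> ell2_on (nonroots V E). \<forall>u\<in>V. cinner g (weight_vec E lam u) = 0}"
    unfolding V'_def C_def by (rule hilbert_sum_ortho_W)
  have "if \<exists>r. is_root V E r
     then orthogonal_sets R (hilbert_sum V' C) \<and> op_kernel (adjoint_in H S) = R + hilbert_sum V' C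
     else op_kernel (adjoint_in H S) = hilbert_sum V' C"
  proof (cases "\<exists>r. is_root V E r")
    case True
    then obtain r where r: "is_root V E r" by blast
    hence "\<And>s. is_root V E s \<longleftrightarrow> s = r" using directed_tree_root_unique[OF tree] by blast
    hence root: "tree_root V E = r" and Vr: "V - nonroots V E = {r}"
      using r by (auto simp: tree_root_def nonroots_def is_root_def)
    have "R \<subseteq> ell2_on {r}"
      unfolding R_def root by (rule cvec.span_minimal) (auto simp: subspace_ell2_on, auto simp: ell2_on_def)
    moreover have "hilbert_sum V' C \<subseteq> ell2_on (nonroots V E)" unfolding HC by blast
    moreover have "{r} \<inter> nonroots V E = {}" using Vr by blast
    ultimately have "orthogonal_sets R (hilbert_sum V' C)"
      unfolding orthogonal_sets_def by (meson cinner_eq_0_disjoint subsetD)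
    moreover have "op_kernel (adjoint_in H S) = R + hilbert_sum V' C"
      unfolding H_def S_def R_def root HC by (rule op_kernel_adjoint_shift_rooted[OF Vr])
    ultimately show ?thesis using True by simp
  next
    case False
    hence "nonroots V E = V" by (auto simp: nonroots_def)
    thus ?thesis using False by (simp add: HC H_def S_def op_kernel_adjoint_shift)
  qed
  thus ?thesis
    using diagonal kernels range_adjoint initial ranges orthogonal by (simp add: U pi)
qed

end
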